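(* For every $n$-point 1-dimensional space (that is, the metric induced by $n\ge2$ distinct points on the real line, given in sorted order) and every integer $k$ with $2\le k\le n$, there exists a 1-spanner with maximum degree at most $3$, diameter $O(k\cdot\log_k n)$, and lightness $O(\log_k n)$, where the implicit constants are absolute. Moreover, this 1-spanner is a planar graph. It can be constructed in time $O(n)$.
   Context: Consider graphs $G$ whose vertices are the given points on the line and in which each edge $(x,y)$ has weight $|x-y|$. $G$ is a 1-spanner if for every pair of distinct points $x,y$ there is a path in $G$ between them of total weight exactly $|x-y|$ (a 1-spanner path). The diameter of a 1-spanner $G$ is the least $\Lambda$ such that every pair of distinct points is joined in $G$ by a 1-spanner path with at most $\Lambda$ edges. The lightness of $G$ is its total edge weight divided by the weight of a minimum spanning tree of the point set (i.e. the distance between the two extreme points). Running time is in the standard real-RAM model. *)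

theory Defs
  imports "HOL-Analysis.Analysis"
begin

section \<open>Finite simple graphs\<close>

text \<open>A graph is given by its vertex set and its set of edges, which are two-element vertex sets.\<close>

definition simple_graph :: "'a set \<Rightarrow> 'a set set \<Rightarrow> bool" where
  "simple_graph V E \<longleftrightarrow> finite V \<and> E \<subseteq> {{x, y} | x y. x \<in> V \<and> y \<in> V \<and> x \<noteq> y}"

definition degree :: "'a set set \<Rightarrow> 'a \<Rightarrow> nat" where
  "degree E v = card {e \<in> E. v \<in> e}"

definition max_degree :: "'a set \<Rightarrow> 'a set set \<Rightarrow> nat" where
  "max_degree V E = Max (degree E ` V)"

definition graph_path :: "'a set set \<Rightarrow> 'a list \<Rightarrow> bool" where
  "graph_path E p \<longleftrightarrow> p \<noteq> [] \<and> distinct p \<and> (\<forall>i. Suc i < length p \<longrightarrow> {p ! i, p ! Suc i} \<in> E)"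

definition graph_connected :: "'a set \<Rightarrow> 'a set set \<Rightarrow> bool" where
  "graph_connected V E \<longleftrightarrow>
     (\<forall>x\<in>V. \<forall>y\<in>V. \<exists>p. graph_path E p \<and> hd p = x \<and> last p = y)"

definition graph_acyclic :: "'a set set \<Rightarrow> bool" where
  "graph_acyclic E \<longleftrightarrow> \<not> (\<exists>p. graph_path E p \<and> 3 \<le> length p \<and> {last p, hd p} \<in> E)"

definition spanning_tree :: "'a set \<Rightarrow> 'a set set \<Rightarrow> bool" where
  "spanning_tree V T \<longleftrightarrow> simple_graph V T \<and> graph_connected V T \<and> graph_acyclic T"

text \<open>
  Planarity is the existence of a drawing without crossings: distinct vertices are placed at
  distinct points of the plane, every edge is a simple arc joining its two endpoints and avoiding
  all other vertices, and two different edges meet at most in common endpoints.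
\<close>

definition planar_graph :: "'a set \<Rightarrow> 'a set set \<Rightarrow> bool" where
  "planar_graph V E \<longleftrightarrow>
     simple_graph V E \<and>
     (\<exists>(pos :: 'a \<Rightarrow> complex) (curve :: 'a set \<Rightarrow> real \<Rightarrow> complex).
        inj_on pos V \<and>
        (\<forall>e\<in>E. arc (curve e) \<and> {pathstart (curve e), pathfinish (curve e)} = pos ` e \<and>
               path_image (curve e) \<inter> pos ` V = pos ` e) \<and>
        (\<forall>e\<in>E. \<forall>f\<in>E. e \<noteq> f \<longrightarrow> path_image (curve e) \<inter> path_image (curve f) = pos ` (e \<inter> f)))"


section \<open>Spanners of points on the line\<close>

text \<open>For a two-element set \<open>{x, y}\<close> this is \<open>\<bar>x - y\<bar>\<close>.\<close>

definition edge_weight :: "real set \<Rightarrow> real" where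
  "edge_weight e = Max e - Min e"

definition graph_weight :: "real set set \<Rightarrow> real" where
  "graph_weight E = (\<Sum>e\<in>E. edge_weight e)"

definition path_weight :: "real list \<Rightarrow> real" where
  "path_weight p = (\<Sum>i<length p - 1. \<bar>p ! i - p ! Suc i\<bar>)"

definition spanner_path :: "real set set \<Rightarrow> real \<Rightarrow> real \<Rightarrow> real list \<Rightarrow> bool" where
  "spanner_path E x y p \<longleftrightarrow>
     graph_path E p \<and> hd p = x \<and> last p = y \<and> path_weight p = \<bar>x - y\<bar>"

definition one_spanner :: "real set \<Rightarrow> real set set \<Rightarrow> bool" where
  "one_spanner V E \<longleftrightarrow>
     simple_graph V E \<and> (\<forall>x\<in>V. \<forall>y\<in>V. x \<noteq> y \<longrightarrow> (\<exists>p. spanner_path E x y p))"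

text \<open>
  Only meaningful for 1-spanners, for which the set of admissible bounds is nonempty.
  The number of edges of a path \<open>p\<close> is \<open>length p - 1\<close>.
\<close>

definition spanner_diameter :: "real set \<Rightarrow> real set set \<Rightarrow> nat" where
  "spanner_diameter V E =
     (LEAST L. \<forall>x\<in>V. \<forall>y\<in>V. x \<noteq> y \<longrightarrow> (\<exists>p. spanner_path E x y p \<and> length p - 1 \<le> L))"

definition mst_weight :: "real set \<Rightarrow> real" where
  "mst_weight V = Min (graph_weight ` {T. spanning_tree V T})"

definition lightness :: "real set \<Rightarrow> real set set \<Rightarrow> real" where
  "lightness V E = graph_weight E / mst_weight V"


section \<open>The real RAM\<close>

text \<open>
  The machine has one memory of words and one of real numbers, each with direct and indirect
  (word-indexed) access. Every instruction has unit cost. Reals support exact arithmetic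
  and comparison, and words can be converted to reals but not conversely (in particular there is
  no rounding). Words are the natural numbers below \<open>b\<close>. An instruction that would produce a
  word \<open>\<ge> b\<close>, or would divide by zero, has no successor configuration; so unit-cost
  arithmetic is available on short integers only.
\<close>

datatype word_op = WPlus | WMinus | WTimes | WDiv | WMod

datatype real_op = RPlus | RMinus | RTimes | RDiv

text \<open>
  In the comments below, \<open>W\<close> and \<open>R\<close> are the two memories. A jump instruction carries the position
  of its target as its last argument; all other instructions continue at the next position.
\<close>

datatype ram_instr =
    WConst nat nat               \<comment> \<open>\<open>W[i] := c\<close>\<close>
  | WMove nat nat                \<comment> \<open>\<open>W[i] := W[j]\<close>\<close>
  | WLoad nat nat                \<comment> \<open>\<open>W[i] := W[W[j]]\<close>\<close>
  | WStore nat nat               \<comment> \<open>\<open>W[W[i]] := W[j]\<close>\<close>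
  | WArith word_op nat nat nat   \<comment> \<open>\<open>W[i] := W[j] op W[l]\<close>\<close>
  | RCast nat nat                \<comment> \<open>\<open>R[i] := W[j]\<close>\<close>
  | RMove nat nat                \<comment> \<open>\<open>R[i] := R[j]\<close>\<close>
  | RLoad nat nat                \<comment> \<open>\<open>R[i] := R[W[j]]\<close>\<close>
  | RStore nat nat               \<comment> \<open>\<open>R[W[i]] := R[j]\<close>\<close>
  | RArith real_op nat nat nat   \<comment> \<open>\<open>R[i] := R[j] op R[l]\<close>\<close>
  | Jump nat
  | JumpWEq nat nat nat          \<comment> \<open>jump if \<open>W[i] = W[j]\<close>\<close>
  | JumpWLess nat nat nat        \<comment> \<open>jump if \<open>W[i] < W[j]\<close>\<close>
  | JumpREq nat nat nat          \<comment> \<open>jump if \<open>R[i] = R[j]\<close>\<close>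
  | JumpRLess nat nat nat        \<comment> \<open>jump if \<open>R[i] < R[j]\<close>\<close>

type_synonym ram_program = "ram_instr list"

text \<open>A configuration consists of the program counter, the words, and the reals.\<close>

type_synonym ram_config = "nat \<times> (nat \<Rightarrow> nat) \<times> (nat \<Rightarrow> real)"

text \<open>Subtraction of words is truncated at zero.\<close>

fun word_op_val :: "word_op \<Rightarrow> nat \<Rightarrow> nat \<Rightarrow> nat option" where
  "word_op_val WPlus x y = Some (x + y)"
| "word_op_val WMinus x y = Some (x - y)"
| "word_op_val WTimes x y = Some (x * y)"
| "word_op_val WDiv x y = (if y = 0 then None else Some (x div y))"
| "word_op_val WMod x y = (if y = 0 then None else Some (x mod y))"

fun real_op_val :: "real_op \<Rightarrow> real \<Rightarrow> real \<Rightarrow> real option" where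
  "real_op_val RPlus x y = Some (x + y)"
| "real_op_val RMinus x y = Some (x - y)"
| "real_op_val RTimes x y = Some (x * y)"
| "real_op_val RDiv x y = (if y = 0 then None else Some (x / y))"

definition put_word :: "nat \<Rightarrow> nat \<Rightarrow> nat \<Rightarrow> ram_config \<Rightarrow> ram_config option" where
  "put_word b i v = (\<lambda>(pc, W, R). if v < b then Some (Suc pc, W(i := v), R) else None)"

definition put_real :: "nat \<Rightarrow> real \<Rightarrow> ram_config \<Rightarrow> ram_config option" where
  "put_real i v = (\<lambda>(pc, W, R). Some (Suc pc, W, R(i := v)))"

definition jump_if :: "bool \<Rightarrow> nat \<Rightarrow> ram_config \<Rightarrow> ram_config option" where
  "jump_if c l = (\<lambda>(pc, W, R). Some (if c then l else Suc pc, W, R))"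

fun ram_exec :: "nat \<Rightarrow> ram_instr \<Rightarrow> ram_config \<Rightarrow> ram_config option" where
  "ram_exec b (WConst i c) (pc, W, R) = put_word b i c (pc, W, R)"
| "ram_exec b (WMove i j) (pc, W, R) = put_word b i (W j) (pc, W, R)"
| "ram_exec b (WLoad i j) (pc, W, R) = put_word b i (W (W j)) (pc, W, R)"
| "ram_exec b (WStore i j) (pc, W, R) = put_word b (W i) (W j) (pc, W, R)"
| "ram_exec b (WArith f i j l) (pc, W, R) =
     Option.bind (word_op_val f (W j) (W l)) (\<lambda>v. put_word b i v (pc, W, R))"
| "ram_exec b (RCast i j) (pc, W, R) = put_real i (real (W j)) (pc, W, R)"
| "ram_exec b (RMove i j) (pc, W, R) = put_real i (R j) (pc, W, R)"
| "ram_exec b (RLoad i j) (pc, W, R) = put_real i (R (W j)) (pc, W, R)"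
| "ram_exec b (RStore i j) (pc, W, R) = put_real (W i) (R j) (pc, W, R)"
| "ram_exec b (RArith f i j l) (pc, W, R) =
     Option.bind (real_op_val f (R j) (R l)) (\<lambda>v. put_real i v (pc, W, R))"
| "ram_exec b (Jump l) (pc, W, R) = jump_if True l (pc, W, R)"
| "ram_exec b (JumpWEq i j l) (pc, W, R) = jump_if (W i = W j) l (pc, W, R)"
| "ram_exec b (JumpWLess i j l) (pc, W, R) = jump_if (W i < W j) l (pc, W, R)"
| "ram_exec b (JumpREq i j l) (pc, W, R) = jump_if (R i = R j) l (pc, W, R)"
| "ram_exec b (JumpRLess i j l) (pc, W, R) = jump_if (R i < R j) l (pc, W, R)"

text \<open>The machine halts when the program counter leaves the program; it then stays put.\<close>

fun ram_run :: "nat \<Rightarrow> ram_program \<Rightarrow> nat \<Rightarrow> ram_config \<Rightarrow> ram_config option" where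
  "ram_run b P 0 c = Some c"
| "ram_run b P (Suc t) c =
     (if fst c < length P then Option.bind (ram_exec b (P ! fst c) c) (ram_run b P t) else Some c)"

text \<open>
  The input is \<open>W[0] = n\<close>, \<open>W[1] = k\<close> and the points in \<open>R[0], \<dots>, R[n - 1]\<close>; everything else is \<open>0\<close>.
\<close>

definition ram_input :: "real list \<Rightarrow> nat \<Rightarrow> ram_config" where
  "ram_input xs k =
     (0, (\<lambda>_. 0)(0 := length xs, 1 := k), (\<lambda>i. if i < length xs then xs ! i else 0))"

text \<open>
  The output is a graph as a list of edges, each edge being given by the input positions of its
  two endpoints. \<open>W[0]\<close> is the length of the list and \<open>W[1]\<close> the address at which it starts.
\<close>

definition ram_output :: "real list \<Rightarrow> (nat \<Rightarrow> nat) \<Rightarrow> real set set \<Rightarrow> bool" where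
  "ram_output xs W E \<longleftrightarrow>
     (\<forall>j < W 0. W (W 1 + 2 * j) < length xs \<and> W (W 1 + 2 * j + 1) < length xs) \<and>
     E = {{xs ! W (W 1 + 2 * j), xs ! W (W 1 + 2 * j + 1)} | j. j < W 0}"

text \<open>\<open>P\<close>, with words below \<open>b\<close>, halts after at most \<open>t\<close> steps and outputs the graph \<open>E\<close>.\<close>

definition ram_constructs ::
  "nat \<Rightarrow> ram_program \<Rightarrow> nat \<Rightarrow> real list \<Rightarrow> nat \<Rightarrow> real set set \<Rightarrow> bool" where
  "ram_constructs b P t xs k E \<longleftrightarrow>
     (\<exists>pc W R. ram_run b P t (ram_input xs k) = Some (pc, W, R) \<and>
        length P \<le> pc \<and> ram_output xs W E)"

end

theory Submission
  imports Defs
begin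

text \<open>
  The spanner is the path through the points together with a matching. A block of level \<open>0\<close> is a
  single position; a block of level \<open>j + 1\<close> is an opening position, \<open>k\<close> consecutive blocks of
  level \<open>j\<close> and a closing position, and its two ends are matched. Since every position is an end of
  exactly one block and blocks are nested or disjoint, the degree is at most \<open>3\<close> and the graph is
  planar. Let \<open>J\<close> be the least level whose blocks have at least \<open>n\<close> positions; truncate such a block
  to the first \<open>n\<close> positions. A monotone path climbs to the ends of the blocks
  around its first point and then descends to its last point, crossing at most \<open>k\<close> siblings on each
  level by their matching edges; the edges of each level have total length at most that of the whole
  point set. So the diameter is at most \<open>4 k J\<close> and the lightness at most \<open>J + 1\<close>, where
  \<open>J \<le> 2 log\<^sub>k n\<close>.

  Blocks are the bracketings of a single left-to-right sweep: a stack holding the opening position of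
  the current block of each level determines in constant time whether a position opens a block,
  closes one, or is a leaf.
\<close>

section \<open>Nested blocks\<close>

primrec bsize :: "nat \<Rightarrow> nat \<Rightarrow> nat" where
  "bsize k 0 = 1"
| "bsize k (Suc j) = k * bsize k j + 2"

text \<open>A leaf is kept as the degenerate pair \<open>(a, a)\<close>, so that every position is
  an end of a pair. Uniqueness of ends then also says that a leaf closes no larger block.\<close>

primrec blocks :: "nat \<Rightarrow> nat \<Rightarrow> nat \<Rightarrow> (nat \<times> nat) set" where
  "blocks k 0 a = {(a, a)}"
| "blocks k (Suc j) a =
     insert (a, a + k * bsize k j + 1) (\<Union>i<k. blocks k j (a + 1 + i * bsize k j))"

lemma bsize_pos: "0 < bsize k j"
  by (cases j) auto

lemma power_le_bsize: "k ^ j \<le> bsize k j"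
proof (induction j)
  case (Suc j)
  then show ?case
    using mult_le_mono2[OF Suc, of k] unfolding bsize.simps power_Suc by linarith
qed simp

text \<open>Guarantees that a level with at least \<open>n\<close> positions exists, and bounds the
  number of levels by \<open>n\<close> for the running time.\<close>

lemma less_bsize:
  assumes "1 \<le> k"
  shows "j < bsize k j"
proof (induction j)
  case (Suc j)
  have "1 * bsize k j \<le> k * bsize k j"
    using assms by (rule mult_le_mono1)
  then show ?case
    using Suc unfolding bsize.simps by linarith
qed simp

lemma child_end_le:
  assumes "i < (i' :: nat)"
  shows "i * s + s \<le> i' * s"
  using mult_le_mono1[of "Suc i" i' s] assms by simp

lemma blocks_bounds:
  "(u, v) \<in> blocks k j a \<Longrightarrow> a \<le> u \<and> u \<le> v \<and> v < a + bsize k j"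
proof (induction j arbitrary: a)
  case (Suc j)
  then consider "(u, v) = (a, a + k * bsize k j + 1)"
    | i where "i < k" "(u, v) \<in> blocks k j (a + 1 + i * bsize k j)"
    by auto
  then show ?case
  proof cases
    case 2
    then show ?thesis
      using Suc.IH[OF 2(2)] child_end_le[OF 2(1), of "bsize k j"] by simp
  qed auto
qed simp

lemma children_order:
  assumes "(u, v) \<in> blocks k j (a + i * bsize k j)" "(u', v') \<in> blocks k j (a + i' * bsize k j)"
    and "i < i'"
  shows "v < u'"
  using blocks_bounds[OF assms(1)] blocks_bounds[OF assms(2)] child_end_le[OF assms(3), of "bsize k j"]
  by linarith

lemma blocks_children_disjoint:
  assumes "i \<noteq> i'"
  shows "blocks k j (a + i * bsize k j) \<inter> blocks k j (a + i' * bsize k j) = {}"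
proof (rule ccontr)
  assume "\<not> ?thesis"
  then obtain u v where "(u, v) \<in> blocks k j (a + i * bsize k j)" "(u, v) \<in> blocks k j (a + i' * bsize k j)"
    by auto
  moreover have "u \<le> v"
    using blocks_bounds calculation by blast
  ultimately show False
    using children_order[of u v k j a i u v i'] children_order[of u v k j a i' u v i] assms by linarith
qed

text \<open>The inequalities are strict, so separated intervals share no end: one relation serves
  both noncrossing and the matching property.\<close>

definition separated :: "nat \<times> nat \<Rightarrow> nat \<times> nat \<Rightarrow> bool" where
  "separated e f \<longleftrightarrow> snd e < fst f \<or> snd f < fst e \<or>
     fst e < fst f \<and> snd f < snd e \<or> fst f < fst e \<and> snd e < snd f"

lemma blocks_separated:
  assumes "e \<in> blocks k j a" "f \<in> blocks k j a" "e \<noteq> f"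
  shows "separated e f"
  using assms
proof (induction j arbitrary: a)
  case (Suc j)
  let ?s = "bsize k j"
  have root: "separated (a, a + k * ?s + 1) g \<and> separated g (a, a + k * ?s + 1)"
    if "g \<in> blocks k j (a + 1 + i * ?s)" "i < k" for g i
    using blocks_bounds[of "fst g" "snd g" k j "a + 1 + i * ?s"] that child_end_le[OF that(2), of ?s]
    by (simp add: separated_def)
  have cousins: "separated e f"
    if "e \<in> blocks k j (a + 1 + i * ?s)" "f \<in> blocks k j (a + 1 + i' * ?s)" "i \<noteq> i'" for i i'
    using children_order[of "fst e" "snd e" k j "a + 1" i "fst f" "snd f" i']
      children_order[of "fst f" "snd f" k j "a + 1" i' "fst e" "snd e" i] that
    by (cases "i < i'") (simp_all add: separated_def)
  have in_cases: "g = (a, a + k * ?s + 1) \<or> (\<exists>i<k. g \<in> blocks k j (a + 1 + i * ?s))"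
    if "g \<in> blocks k (Suc j) a" for g
    using that by auto
  show ?case
    using in_cases[OF Suc.prems(1)] in_cases[OF Suc.prems(2)] Suc.prems(3) Suc.IH root cousins
    by metis
qed simp

text \<open>The matching property: it bounds the degree, and it makes the start of a block
  determined by its closing position.\<close>

lemma blocks_endpoint_unique:
  assumes "(u, v) \<in> blocks k j a" "(u', v') \<in> blocks k j a" "{u, v} \<inter> {u', v'} \<noteq> {}"
  shows "u = u' \<and> v = v'"
proof (rule ccontr)
  assume "\<not> (u = u' \<and> v = v')"
  then have "separated (u, v) (u', v')"
    using blocks_separated[OF assms(1,2)] by simp
  then show False
    using blocks_bounds[OF assms(1)] blocks_bounds[OF assms(2)] assms(3)
    by (auto simp: separated_def)
qed

lemma blocks_root: "(a, a + bsize k j - 1) \<in> blocks k j a"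
  by (cases j) auto

lemma blocks_child: "i < k \<Longrightarrow> blocks k j (a + 1 + i * bsize k j) \<subseteq> blocks k (Suc j) a"
  by auto

lemma finite_blocks: "finite (blocks k j a)"
  by (induction j arbitrary: a) auto

section \<open>Total length of the blocks\<close>

lemma sum_children_le:
  fixes x :: "nat \<Rightarrow> real"
  assumes "mono x" "0 < s"
  shows "(\<Sum>i<m. x (a + i * s + s - 1) - x (a + i * s)) \<le> x (a + m * s) - x a"
proof (induction m)
  case (Suc m)
  have "x (a + m * s + s - 1) \<le> x (a + Suc m * s)"
    by (rule monoD[OF assms(1)]) auto
  then show ?case
    using Suc by simp
qed simp

text \<open>Blocks of one level are disjoint, so each level weighs at most the length of the whole
  interval. The factor is \<open>j\<close> and not \<open>j + 1\<close> because level
  \<open>0\<close> consists of degenerate pairs of length zero.\<close>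

lemma sum_blocks_le:
  fixes x :: "nat \<Rightarrow> real"
  assumes "mono x"
  shows "(\<Sum>(u, v)\<in>blocks k j a. x v - x u) \<le> real j * (x (a + bsize k j - 1) - x a)"
proof (induction j arbitrary: a)
  case (Suc j)
  let ?s = "bsize k j" and ?w = "\<lambda>(u, v). x v - x u"
  let ?D = "x (a + bsize k (Suc j) - 1) - x a"
  have "sum ?w (\<Union>i<k. blocks k j (a + 1 + i * ?s)) = (\<Sum>i<k. sum ?w (blocks k j (a + 1 + i * ?s)))"
    by (rule sum.UNION_disjoint) (simp_all add: finite_blocks blocks_children_disjoint del: One_nat_def add_Suc_right)
  also have "\<dots> \<le> (\<Sum>i<k. real j * (x (a + 1 + i * ?s + ?s - 1) - x (a + 1 + i * ?s)))"
    by (intro sum_mono Suc.IH)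
  also have "\<dots> \<le> real j * (x (a + 1 + k * ?s) - x (a + 1))"
    unfolding sum_distrib_left[symmetric]
    by (intro mult_left_mono sum_children_le assms bsize_pos) simp
  also have "\<dots> \<le> real j * ?D"
    using monoD[OF assms, of a "a + 1"] by (intro mult_left_mono) (auto simp: add_ac)
  finally have children: "sum ?w (\<Union>i<k. blocks k j (a + 1 + i * ?s)) \<le> real j * ?D" .
  have "(a, a + k * ?s + 1) \<notin> (\<Union>i<k. blocks k j (a + 1 + i * ?s))"
    using blocks_bounds by fastforce
  then have "sum ?w (blocks k (Suc j) a) = ?D + sum ?w (\<Union>i<k. blocks k j (a + 1 + i * ?s))"
    by (simp add: finite_blocks add_ac)
  then show ?case
    using children by (simp add: algebra_simps)
qed simp

section \<open>Short increasing paths inside a block\<close>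

text \<open>
  Truncation to \<open>n\<close> positions can be ignored for paths: every pair in \<open>F\<close> will be increasing, so a
  path that ends below \<open>n\<close> stays below \<open>n\<close>.
\<close>

definition hops :: "(nat \<times> nat) set \<Rightarrow> nat \<Rightarrow> nat \<Rightarrow> nat \<Rightarrow> bool" where
  "hops F L u v \<longleftrightarrow> (\<exists>l\<le>L. (u, v) \<in> F ^^ l)"

lemma hops_refl: "hops F L u u"
  unfolding hops_def by (intro exI[of _ 0]) simp

lemma hops_edge: "(u, v) \<in> F \<Longrightarrow> hops F (Suc L) u v"
  unfolding hops_def by (intro exI[of _ 1]) simp

lemma hops_trans: "hops F L u v \<Longrightarrow> hops F L' v w \<Longrightarrow> hops F (L + L') u w"
  unfolding hops_def by (metis add_mono relpow_add relcompI)

lemma hops_mono: "hops F L u v \<Longrightarrow> L \<le> L' \<Longrightarrow> hops F L' u v"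
  unfolding hops_def by (meson order_trans)

context
  fixes F :: "(nat \<times> nat) set" and k :: nat
  assumes path_edges: "(i, Suc i) \<in> F" and k_pos: "1 \<le> k"
begin

lemma hops_Suc: "hops F (Suc L) i (Suc i)"
  by (simp add: hops_edge path_edges)

lemma hops_cross:
  assumes "{e \<in> blocks k j a. fst e < snd e} \<subseteq> F"
  shows "hops F 1 a (a + bsize k j - 1)"
proof (cases "j = 0")
  case False
  then obtain j' where "j = Suc j'"
    using not0_implies_Suc by blast
  then show ?thesis
    using assms hops_edge[of a _ F 0] by auto
qed (simp add: hops_refl)

lemma hops_next:
  assumes "{e \<in> blocks k j a. fst e < snd e} \<subseteq> F"
  shows "hops F 2 a (a + bsize k j)"
  using hops_trans[OF hops_cross[OF assms] hops_Suc[of 0]] bsize_pos[of k j]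
  by (simp add: numeral_2_eq_2)

lemma hops_siblings:
  assumes "{e \<in> blocks k (Suc j) a. fst e < snd e} \<subseteq> F" "i + d \<le> k"
  shows "hops F (2 * d) (a + 1 + i * bsize k j) (a + 1 + (i + d) * bsize k j)"
  using assms(2)
proof (induction d)
  case (Suc d)
  have "hops F 2 (a + 1 + (i + d) * bsize k j) (a + 1 + (i + d) * bsize k j + bsize k j)"
    using assms(1) Suc.prems blocks_child[of "i + d" k j a] by (intro hops_next) auto
  from hops_trans[OF Suc.IH this] Suc.prems show ?case
    by (simp add: algebra_simps)
qed (simp add: hops_refl)

lemma block_cases:
  assumes "a \<le> x" "x < a + bsize k (Suc j)"
  obtains "x = a" | "x = a + bsize k (Suc j) - 1"
  | i where "i < k" "a + 1 + i * bsize k j \<le> x" "x < a + 1 + i * bsize k j + bsize k j"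
proof -
  let ?s = "bsize k j"
  consider "x = a" | "x = a + bsize k (Suc j) - 1" | "a < x" "x < a + 1 + k * ?s"
    using assms by fastforce
  then show thesis
  proof cases
    case 3
    \<comment> \<open>Children start at \<open>a + 1\<close>, so division by their common size finds
      the one that contains \<open>x\<close>.\<close>
    define i where "i = (x - a - 1) div ?s"
    have div_mod: "x - a - 1 = i * ?s + (x - a - 1) mod ?s"
      unfolding i_def by (rule div_mult_mod_eq[symmetric])
    have "(x - a - 1) mod ?s < ?s"
      using bsize_pos[of k j] by simp
    moreover have "i < k"
      unfolding i_def using 3 bsize_pos[of k j] by (intro less_mult_imp_div_less) auto
    ultimately show thesis
      using that(3)[of i] div_mod 3 by linarith
  qed (use that in auto)
qed

text \<open>Leave the child of \<open>x\<close> at its end, step to the next sibling and cross the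
  remaining ones. The level adds \<open>1 + 2 * (k - Suc i) \<le> 2 * k\<close> hops.\<close>

lemma hops_to_end:
  assumes "{e \<in> blocks k j a. fst e < snd e} \<subseteq> F" "a \<le> x" "x < a + bsize k j"
  shows "hops F (2 * k * j) x (a + bsize k j - 1)"
  using assms
proof (induction j arbitrary: a)
  case (Suc j)
  let ?s = "bsize k j"
  show ?case
  proof (cases rule: block_cases[OF Suc.prems(2,3)])
    case 1
    then show ?thesis
      using hops_mono[OF hops_cross[OF Suc.prems(1)], of "2 * k * Suc j"] k_pos by simp
  next
    case 2
    then show ?thesis
      by (simp add: hops_refl)
  next
    case (3 i)
    have sub: "{e \<in> blocks k j (a + 1 + i * ?s). fst e < snd e} \<subseteq> F"
      using Suc.prems(1) blocks_child[OF 3(1), of j a] by blast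
    have "hops F (2 * k * j) x (a + 1 + i * ?s + ?s - 1)"
      using Suc.IH[OF sub] 3 by simp
    from hops_trans[OF this hops_Suc[of 0]]
    have "hops F (2 * k * j + 1) x (a + 1 + Suc i * ?s)"
      using bsize_pos[of k j] by (simp add: algebra_simps)
    from hops_trans[OF this hops_siblings[OF Suc.prems(1), of "Suc i" "k - Suc i"]]
    have "hops F (2 * k * j + 1 + 2 * (k - Suc i)) x (a + bsize k (Suc j) - 1)"
      using 3 by simp
    then show ?thesis
      by (rule hops_mono) (use 3 in \<open>simp add: algebra_simps\<close>)
  qed
next
  case 0
  then have "x = a"
    by simp
  then show ?case
    by (simp add: hops_refl)
qed

text \<open>Mirror image of \<open>hops_to_end\<close>: one step into the first child,
  \<open>i\<close> siblings crossed, then the descent. The level adds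
  \<open>1 + 2 * i \<le> 2 * k\<close> hops.\<close>

lemma hops_from_start:
  assumes "{e \<in> blocks k j a. fst e < snd e} \<subseteq> F" "a \<le> x" "x < a + bsize k j"
  shows "hops F (2 * k * j) a x"
  using assms
proof (induction j arbitrary: a)
  case (Suc j)
  let ?s = "bsize k j"
  show ?case
  proof (cases rule: block_cases[OF Suc.prems(2,3)])
    case 1
    then show ?thesis
      by (simp add: hops_refl)
  next
    case 2
    then show ?thesis
      using hops_mono[OF hops_cross[OF Suc.prems(1)], of "2 * k * Suc j"] k_pos by simp
  next
    case (3 i)
    have sub: "{e \<in> blocks k j (a + 1 + i * ?s). fst e < snd e} \<subseteq> F"
      using Suc.prems(1) blocks_child[OF 3(1), of j a] by blast
    have "hops F (1 + 2 * i) a (a + 1 + i * ?s)"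
      using hops_trans[of F 1 a "Suc a", OF hops_Suc[of 0 a, folded One_nat_def]]
        hops_siblings[OF Suc.prems(1), of 0 i] 3 by simp
    from hops_trans[OF this Suc.IH[OF sub]]
    have "hops F (1 + 2 * i + 2 * k * j) a x"
      using 3 Suc.prems by simp
    then show ?thesis
      by (rule hops_mono) (use 3 in \<open>simp add: algebra_simps\<close>)
  qed
next
  case 0
  then have "x = a"
    by simp
  then show ?case
    by (simp add: hops_refl)
qed

text \<open>Recursion goes on only while both points lie in the same child. Once they separate, one
  climb, one crossing of siblings and one descent finish the path, so the costs
  \<open>2 * k * j\<close> of climb and descent are paid only once.\<close>

lemma hops_within:
  assumes "{e \<in> blocks k j a. fst e < snd e} \<subseteq> F"
    and "a \<le> x" "x \<le> y" "y < a + bsize k j"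
  shows "hops F (4 * k * j) x y"
  using assms
proof (induction j arbitrary: a)
  case (Suc j)
  let ?s = "bsize k j"
  have x_bound: "x < a + bsize k (Suc j)" and y_bound: "a \<le> y"
    using Suc.prems by auto
  have from_start: "hops F (4 * k * Suc j) a y"
    by (rule hops_mono[OF hops_from_start[OF Suc.prems(1)]]) (use Suc.prems in auto)
  have to_end: "hops F (4 * k * Suc j) x (a + bsize k (Suc j) - 1)"
    by (rule hops_mono[OF hops_to_end[OF Suc.prems(1)]]) (use Suc.prems in auto)
  have sub: "{e \<in> blocks k j (a + 1 + i * ?s). fst e < snd e} \<subseteq> F" if "i < k" for i
    using Suc.prems(1) blocks_child[OF that, of j a] by blast
  show ?case
  proof (cases rule: block_cases[OF Suc.prems(2) x_bound])
    case 2
    then have "y = x"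
      using Suc.prems(3,4) by linarith
    then show ?thesis
      by (simp add: hops_refl)
  next
    case x: (3 i)
    show ?thesis
    proof (cases rule: block_cases[OF y_bound Suc.prems(4)])
      case y: (3 i')
      consider "i' < i" | "i' = i" | "i < i'"
        by linarith
      then show ?thesis
      proof cases
        case 1
        then show ?thesis
          using x y Suc.prems(3) child_end_le[of i' i ?s] by linarith
      next
        case 2
        then show ?thesis
          using hops_mono[OF Suc.IH[OF sub[OF x(1)]], of "4 * k * Suc j"] x y Suc.prems by simp
      next
        case 3
        have "hops F (2 * k * j) x (a + 1 + i * ?s + ?s - 1)"
          using hops_to_end[OF sub[OF x(1)]] x by simp
        from hops_trans[OF this hops_Suc[of 0]]
        have "hops F (2 * k * j + 1) x (a + 1 + Suc i * ?s)"
          using bsize_pos[of k j] by (simp add: algebra_simps)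
        from hops_trans[OF this hops_siblings[OF Suc.prems(1), of "Suc i" "i' - Suc i"]]
        have "hops F (2 * k * j + 1 + 2 * (i' - Suc i)) x (a + 1 + i' * ?s)"
          using 3 y by simp
        from hops_trans[OF this hops_from_start[OF sub[OF y(1)]]]
        have "hops F (2 * k * j + 1 + 2 * (i' - Suc i) + 2 * k * j) x y"
          using y Suc.prems by simp
        then show ?thesis
          by (rule hops_mono) (use 3 y in \<open>simp add: algebra_simps\<close>)
      qed
    qed (use to_end Suc.prems in \<open>auto simp: hops_refl\<close>)
  qed (use from_start in auto)
next
  case 0
  then have "y = x"
    by simp
  then show ?case
    by (simp add: hops_refl)
qed

end

section \<open>Graphs on the line\<close>

lemma telescope_abs:
  fixes f :: "nat \<Rightarrow> real"
  assumes "\<And>i. i < l \<Longrightarrow> f i \<le> f (Suc i)"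
  shows "(\<Sum>i<l. \<bar>f i - f (Suc i)\<bar>) = f l - f 0"
  using assms by (induction l) auto

lemma abs_diff_le_sum:
  fixes f :: "nat \<Rightarrow> real"
  shows "\<bar>f l - f 0\<bar> \<le> (\<Sum>i<l. \<bar>f i - f (Suc i)\<bar>)"
  by (induction l) auto

lemma edge_weight_doubleton: "edge_weight {x, y} = \<bar>x - y\<bar>"
  by (auto simp: edge_weight_def max_def min_def)

lemma simple_graph_edgeD:
  assumes "simple_graph V E" "e \<in> E"
  obtains x y where "e = {x, y}" "x \<in> V" "y \<in> V" "x \<noteq> y"
  using assms unfolding simple_graph_def by blast

text \<open>A simple path uses each edge at most once, and all other edges have nonnegative
  weight.\<close>

lemma graph_path_weight_le:
  assumes "simple_graph V E" "graph_path E p"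
  shows "path_weight p \<le> graph_weight E"
proof -
  let ?e = "\<lambda>i. {p ! i, p ! Suc i}"
  have dist: "distinct p" and edges: "\<And>i. Suc i < length p \<Longrightarrow> ?e i \<in> E"
    using assms by (auto simp: graph_path_def)
  have "finite (Pow V)" "E \<subseteq> Pow V"
    using assms(1) by (auto simp: simple_graph_def)
  then have fin: "finite E"
    by (rule finite_subset[rotated])
  have inj: "inj_on ?e {..<length p - 1}"
  proof (rule inj_onI)
    fix i j assume ij: "i \<in> {..<length p - 1}" "j \<in> {..<length p - 1}" "?e i = ?e j"
    have "p ! i = p ! j \<or> p ! i = p ! Suc j \<and> p ! Suc i = p ! j"
      using ij(3) by (auto simp: doubleton_eq_iff)
    then have "i = j \<or> i = Suc j \<and> Suc i = j"
      using ij dist by (auto simp: nth_eq_iff_index_eq)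
    then show "i = j"
      by auto
  qed
  have "path_weight p = (\<Sum>i<length p - 1. edge_weight (?e i))"
    by (simp add: path_weight_def edge_weight_doubleton)
  also have "\<dots> = sum edge_weight (?e ` {..<length p - 1})"
    using inj by (simp add: sum.reindex)
  also have "\<dots> \<le> graph_weight E"
    unfolding graph_weight_def
  proof (rule sum_mono2[OF fin])
    show "?e ` {..<length p - 1} \<subseteq> E"
    proof (rule image_subsetI)
      fix i assume "i \<in> {..<length p - 1}"
      then have "Suc i < length p"
        by auto
      then show "?e i \<in> E"
        by (rule edges)
    qed
    show "0 \<le> edge_weight e" if e: "e \<in> E - ?e ` {..<length p - 1}" for e
    proof -
      obtain x y where "e = {x, y}"
        using simple_graph_edgeD[OF assms(1), of e] e by blast
      then show ?thesis
        by (simp add: edge_weight_doubleton)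
    qed
  qed
  finally show ?thesis .
qed

text \<open>Some path joins the two points, and the triangle inequality applies to it. With the
  extreme points this bounds every spanning tree from below.\<close>

lemma connected_graph_weight_ge:
  assumes "simple_graph V E" "graph_connected V E" "x \<in> V" "y \<in> V"
  shows "\<bar>x - y\<bar> \<le> graph_weight E"
proof -
  obtain p where p: "graph_path E p" "hd p = x" "last p = y"
    using assms unfolding graph_connected_def by blast
  then have "p \<noteq> []"
    by (simp add: graph_path_def)
  then have "\<bar>x - y\<bar> \<le> path_weight p"
    using abs_diff_le_sum[of "nth p" "length p - 1"] p
    by (simp add: path_weight_def hd_conv_nth last_conv_nth abs_minus_commute)
  then show ?thesis
    using graph_path_weight_le[OF assms(1) p(1)] by linarith
qed

section \<open>Graphs on the points given by increasing pairs of positions\<close>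

definition line_graph :: "real list \<Rightarrow> (nat \<times> nat) set \<Rightarrow> real set set" where
  "line_graph xs F = (\<lambda>(u, v). {xs ! u, xs ! v}) ` F"

definition path_pairs :: "nat \<Rightarrow> (nat \<times> nat) set" where
  "path_pairs n = {(i, Suc i) | i. Suc i < n}"

lemma line_graphI: "(u, v) \<in> F \<Longrightarrow> {xs ! u, xs ! v} \<in> line_graph xs F"
  by (force simp: line_graph_def)

context
  fixes xs :: "real list" and F :: "(nat \<times> nat) set"
  assumes sorted: "sorted_wrt (<) xs"
    and ordered: "\<And>u v. (u, v) \<in> F \<Longrightarrow> u < v \<and> v < length xs"
begin

lemma nth_less_iff: "i < length xs \<Longrightarrow> j < length xs \<Longrightarrow> xs ! i < xs ! j \<longleftrightarrow> i < j"
  using sorted by (metis linorder_neqE_nat not_less_iff_gr_or_eq sorted_wrt_nth_less)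

lemma nth_eq_iff: "i < length xs \<Longrightarrow> j < length xs \<Longrightarrow> xs ! i = xs ! j \<longleftrightarrow> i = j"
  using nth_less_iff by (metis nat_neq_iff)

lemma nth_le_iff: "i < length xs \<Longrightarrow> j < length xs \<Longrightarrow> xs ! i \<le> xs ! j \<longleftrightarrow> i \<le> j"
  using nth_less_iff by (metis linorder_not_le)

lemma simple_line_graph: "simple_graph (set xs) (line_graph xs F)"
proof -
  have "{xs ! u, xs ! v} \<in> {{x, y} | x y. x \<in> set xs \<and> y \<in> set xs \<and> x \<noteq> y}" if "(u, v) \<in> F" for u v
    using ordered[OF that] nth_eq_iff[of u v] by fastforce
  then show ?thesis
    by (auto simp: simple_graph_def line_graph_def)
qed

text \<open>Pairs of \<open>F\<close> increase, so a walk in \<open>F\<close> visits points from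
  left to right: no vertex repeats, and the weight telescopes to the distance of the ends. The
  reversed list serves the opposite order of the ends.\<close>

lemma spanner_path_relpow:
  assumes "(u, v) \<in> F ^^ l" "v < length xs"
  shows "\<exists>p. spanner_path (line_graph xs F) (xs ! u) (xs ! v) p \<and> length p - 1 = l"
    and "\<exists>p. spanner_path (line_graph xs F) (xs ! v) (xs ! u) p \<and> length p - 1 = l"
proof -
  obtain f where f: "f 0 = u" "f l = v" "\<And>i. i < l \<Longrightarrow> (f i, f (Suc i)) \<in> F"
    using assms(1) by (auto simp: relpow_fun_conv)
  have less: "f i < f j" if "i < j" "j \<le> l" for i j
    using that
  proof (induction j)
    case (Suc j)
    then show ?case
      using ordered[OF f(3)[of j]] by (cases "i = j") auto
  qed simp
  have bound: "f i < length xs" if "i \<le> l" for i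
    using less[of i l] that assms(2) f(2) by (cases "i = l") auto
  define p where "p = map (\<lambda>i. xs ! f i) [0..<Suc l]"
  have nth: "p ! i = xs ! f i" if "i \<le> l" for i
    using that by (simp add: p_def del: upt_Suc)
  have len: "length p = Suc l"
    by (simp add: p_def)
  have ne: "p \<noteq> []"
    using len by auto
  have ends: "hd p = xs ! u" "last p = xs ! v"
    using ne f by (simp_all add: hd_conv_nth last_conv_nth len nth)
  have "distinct p"
    unfolding p_def distinct_map
  proof (intro conjI inj_onI)
    fix i j assume ij: "i \<in> set [0..<Suc l]" "j \<in> set [0..<Suc l]" "xs ! f i = xs ! f j"
    then have "i \<le> l" "j \<le> l"
      by auto
    then show "i = j"
      using nth_eq_iff[of "f i" "f j"] bound ij(3) less[of i j] less[of j i] by (metis nat_neq_iff)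
  qed simp
  moreover have edge: "{p ! i, p ! Suc i} \<in> line_graph xs F" if "Suc i < length p" for i
    using that f(3) by (simp add: nth len line_graphI)
  ultimately have path: "graph_path (line_graph xs F) p"
    using ne by (simp add: graph_path_def)
  have weight: "path_weight p = xs ! v - xs ! u"
  proof -
    have "path_weight p = (\<Sum>i<l. \<bar>xs ! f i - xs ! f (Suc i)\<bar>)"
      by (simp add: path_weight_def len nth)
    also have "\<dots> = xs ! f l - xs ! f 0"
      by (rule telescope_abs) (use bound less nth_le_iff in \<open>simp add: less_imp_le\<close>)
    finally show ?thesis
      by (simp add: f)
  qed
  have uv: "xs ! u \<le> xs ! v"
    using less[of 0 l] f(1,2) nth_le_iff[of u v] bound[of 0] bound[of l] by (cases "l = 0") auto
  show "\<exists>p. spanner_path (line_graph xs F) (xs ! u) (xs ! v) p \<and> length p - 1 = l"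
    using path ends weight uv len by (intro exI[of _ p]) (simp add: spanner_path_def)
  have rev_nth': "rev p ! i = p ! (l - i)" if "i \<le> l" for i
    using that by (simp add: rev_nth len)
  have "graph_path (line_graph xs F) (rev p)"
    unfolding graph_path_def
  proof (intro conjI allI impI)
    fix i assume "Suc i < length (rev p)"
    then have "i < l" "Suc (l - Suc i) = l - i"
      by (auto simp: len)
    then show "{rev p ! i, rev p ! Suc i} \<in> line_graph xs F"
      using edge[of "l - Suc i"] by (simp add: rev_nth' len insert_commute)
  qed (use path in \<open>auto simp: graph_path_def\<close>)
  moreover have "path_weight (rev p) = path_weight p"
  proof -
    have "path_weight (rev p) = (\<Sum>i<l. \<bar>p ! (l - i) - p ! (l - Suc i)\<bar>)"
      by (simp add: path_weight_def len rev_nth')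
    also have "\<dots> = (\<Sum>i<l. \<bar>p ! Suc (l - Suc i) - p ! (l - Suc i)\<bar>)"
      by (intro sum.cong refl) (simp add: Suc_diff_Suc)
    also have "\<dots> = (\<Sum>i<l. \<bar>p ! Suc i - p ! i\<bar>)"
      by (rule sum.nat_diff_reindex)
    also have "\<dots> = path_weight p"
      by (simp add: path_weight_def len abs_minus_commute)
    finally show ?thesis .
  qed
  moreover have "hd (rev p) = xs ! v" "last (rev p) = xs ! u"
    unfolding hd_rev last_rev by (rule ends)+
  moreover have "length (rev p) - 1 = l"
    by (simp add: len)
  moreover have "path_weight p = \<bar>xs ! v - xs ! u\<bar>"
    using weight uv by linarith
  ultimately show "\<exists>p. spanner_path (line_graph xs F) (xs ! v) (xs ! u) p \<and> length p - 1 = l"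
    unfolding spanner_path_def by metis
qed

lemma spanner_path_between:
  assumes "\<And>u v. u < v \<Longrightarrow> v < length xs \<Longrightarrow> \<exists>l\<le>L. (u, v) \<in> F ^^ l"
    and "x \<in> set xs" "y \<in> set xs" "x \<noteq> y"
  shows "\<exists>p. spanner_path (line_graph xs F) x y p \<and> length p - 1 \<le> L"
proof -
  obtain i j where ij: "i < length xs" "j < length xs" "x = xs ! i" "y = xs ! j"
    using assms(2,3) by (auto simp: in_set_conv_nth)
  consider "i < j" | "j < i"
    using ij assms(4) by (metis nat_neq_iff)
  then show ?thesis
    using assms(1) spanner_path_relpow ij by cases metis+
qed

lemma one_spanner_line_graph:
  assumes "\<And>u v. u < v \<Longrightarrow> v < length xs \<Longrightarrow> \<exists>l\<le>L. (u, v) \<in> F ^^ l"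
  shows "one_spanner (set xs) (line_graph xs F)"
    and "spanner_diameter (set xs) (line_graph xs F) \<le> L"
proof -
  note paths = spanner_path_between[OF assms]
  show "one_spanner (set xs) (line_graph xs F)"
    unfolding one_spanner_def using paths simple_line_graph by blast
  show "spanner_diameter (set xs) (line_graph xs F) \<le> L"
    unfolding spanner_diameter_def by (rule Least_le) (use paths in blast)
qed

lemma graph_weight_line_graph_le:
  assumes "finite F"
  shows "graph_weight (line_graph xs F) \<le> (\<Sum>(u, v)\<in>F. xs ! v - xs ! u)"
proof -
  have "graph_weight (line_graph xs F) \<le> (\<Sum>e\<in>F. edge_weight (case e of (u, v) \<Rightarrow> {xs ! u, xs ! v}))"
    unfolding graph_weight_def line_graph_def
    \<comment> \<open>Different pairs mapped to one edge would only lower the left side, so an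
      inequality for images is enough.\<close>
    by (rule sum_image_le[OF assms, unfolded comp_def]) (auto simp: edge_weight_doubleton)
  also have "\<dots> = (\<Sum>(u, v)\<in>F. xs ! v - xs ! u)"
  proof (intro sum.cong refl)
    fix e assume "e \<in> F"
    then have "xs ! fst e < xs ! snd e"
      using ordered[of "fst e" "snd e"] nth_less_iff by simp
    then show "edge_weight (case e of (u, v) \<Rightarrow> {xs ! u, xs ! v}) = (case e of (u, v) \<Rightarrow> xs ! v - xs ! u)"
      by (cases e) (simp add: edge_weight_doubleton)
  qed
  finally show ?thesis .
qed

lemma max_degree_line_graph:
  assumes F: "F = path_pairs (length xs) \<union> M" and "xs \<noteq> []"
    and matching: "\<And>u v u' v'. (u, v) \<in> M \<Longrightarrow> (u', v') \<in> M \<Longrightarrow> {u, v} \<inter> {u', v'} \<noteq> {} \<Longrightarrow> u = u' \<and> v = v'"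
  shows "max_degree (set xs) (line_graph xs F) \<le> 3"
proof -
  have "degree (line_graph xs F) x \<le> 3" if x: "x \<in> set xs" for x
  proof -
    obtain i where i: "i < length xs" "x = xs ! i"
      using x by (metis in_set_conv_nth)
    let ?g = "\<lambda>(u, v). {xs ! u, xs ! v}"
    define Mi where "Mi = {e \<in> M. i \<in> {fst e, snd e}}"
    have "e' = e" if "e \<in> Mi" "e' \<in> Mi" for e e'
      using that matching[of "fst e" "snd e" "fst e'" "snd e'"] unfolding Mi_def
      by (auto simp: prod_eq_iff)
    then obtain e where "Mi \<subseteq> {e}"
      by blast
    then have Mi: "?g ` Mi \<subseteq> {?g e}"
      by blast
    \<comment> \<open>Two path edges and at most one matching edge. At the ends of the list
      \<open>i - 1\<close> collapses to \<open>0\<close> or \<open>Suc i\<close> is out of range;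
      this is harmless, since only a superset with at most three elements is wanted.\<close>
    have "{e \<in> line_graph xs F. x \<in> e} \<subseteq> {{xs ! (i - 1), xs ! i}, {xs ! i, xs ! Suc i}} \<union> ?g ` Mi"
    proof
      fix e assume "e \<in> {e \<in> line_graph xs F. x \<in> e}"
      then obtain u v where uv: "(u, v) \<in> F" "e = {xs ! u, xs ! v}" "x \<in> e"
        by (auto simp: line_graph_def)
      then have "i = u \<or> i = v"
        using i ordered[OF uv(1)] nth_eq_iff by auto
      then show "e \<in> {{xs ! (i - 1), xs ! i}, {xs ! i, xs ! Suc i}} \<union> ?g ` Mi"
      proof -
        consider "v = Suc u" | "(u, v) \<in> Mi"
          using uv(1) \<open>i = u \<or> i = v\<close> unfolding F path_pairs_def Mi_def by auto
        then show ?thesis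
        proof cases
          case 1
          then show ?thesis
            using \<open>i = u \<or> i = v\<close> uv(2) by auto
        next
          case 2
          then have "?g (u, v) \<in> ?g ` Mi"
            by (rule imageI)
          then show ?thesis
            using uv(2) by simp
        qed
      qed
    qed
    also have "\<dots> \<subseteq> {{xs ! (i - 1), xs ! i}, {xs ! i, xs ! Suc i}, ?g e}"
      using Mi by blast
    finally have "card {e \<in> line_graph xs F. x \<in> e} \<le> card {{xs ! (i - 1), xs ! i}, {xs ! i, xs ! Suc i}, ?g e}"
      by (intro card_mono) auto
    also have "\<dots> \<le> 3"
      by (auto simp: card_insert_if)
    finally show ?thesis
      by (simp add: degree_def)
  qed
  then show ?thesis
    unfolding max_degree_def using assms(2) by simp
qed

end

section \<open>The path through the points as a spanning tree\<close>

lemma relpow_path_pairs: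
  assumes "v < n" "u \<le> v"
  shows "(u, v) \<in> path_pairs n ^^ (v - u)"
  using assms(2,1)
proof (induction v rule: dec_induct)
  case (step v)
  then have "(u, v) \<in> path_pairs n ^^ (v - u)" "(v, Suc v) \<in> path_pairs n"
    by (auto simp: path_pairs_def)
  then have "(u, Suc v) \<in> path_pairs n ^^ Suc (v - u)"
    by (auto intro: relpow_Suc_I)
  then show ?case
    using step by (simp add: Suc_diff_le)
qed simp

lemma path_pairs_ordered: "(u, v) \<in> path_pairs n \<Longrightarrow> u < v \<and> v < n"
  by (auto simp: path_pairs_def)

text \<open>
  A walk with steps of size \<open>1\<close> that never revisits a position cannot turn back, so its ends are too
  far apart to be adjacent.
\<close>

lemma acyclic_path_pairs:
  assumes "sorted_wrt (<) xs"
  shows "graph_acyclic (line_graph xs (path_pairs (length xs)))"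
  unfolding graph_acyclic_def
proof (intro notI, elim exE conjE)
  let ?E = "line_graph xs (path_pairs (length xs))"
  fix p assume p: "graph_path ?E p" "3 \<le> length p" "{last p, hd p} \<in> ?E"
  have eq_iff: "xs ! i = xs ! j \<longleftrightarrow> i = j" if "i < length xs" "j < length xs" for i j
    using nth_eq_iff[OF assms path_pairs_ordered] that by blast
  define pos where "pos x = (THE i. i < length xs \<and> xs ! i = x)" for x
  have pos_nth: "pos (xs ! i) = i" if "i < length xs" for i
    unfolding pos_def using that eq_iff by (intro the_equality) auto
  have edge: "\<bar>int (pos x) - int (pos y)\<bar> = 1 \<and> x = xs ! pos x \<and> y = xs ! pos y" if xy: "{x, y} \<in> ?E" for x y
  proof -
    obtain i where i: "Suc i < length xs" "{x, y} = {xs ! i, xs ! Suc i}"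
      using xy by (auto simp: line_graph_def path_pairs_def)
    then consider "x = xs ! i" "y = xs ! Suc i" | "y = xs ! i" "x = xs ! Suc i"
      by (auto simp: doubleton_eq_iff)
    then show ?thesis
      using i pos_nth[of i] pos_nth[of "Suc i"] by cases auto
  qed
  define q where "q i = int (pos (p ! i))" for i
  have ne: "p \<noteq> []"
    using p by auto
  have step: "\<bar>q i - q (Suc i)\<bar> = 1" if "Suc i < length p" for i
    using edge p(1) that by (auto simp: graph_path_def q_def)
  have turn: "q (Suc (Suc i)) \<noteq> q i" if "Suc (Suc i) < length p" for i
  proof
    assume "q (Suc (Suc i)) = q i"
    then have "pos (p ! Suc (Suc i)) = pos (p ! i)"
      by (simp add: q_def)
    moreover have "p ! i = xs ! pos (p ! i)" "p ! Suc (Suc i) = xs ! pos (p ! Suc (Suc i))"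
      using edge[of "p ! i" "p ! Suc i"] edge[of "p ! Suc i" "p ! Suc (Suc i)"] p(1) that
      by (auto simp: graph_path_def)
    ultimately have "p ! Suc (Suc i) = p ! i"
      by metis
    then show False
      using p(1) that by (simp add: graph_path_def nth_eq_iff_index_eq)
  qed
  have straight: "q i - q 0 = int i * (q 1 - q 0)" if "i < length p" for i
    using that
  proof (induction i rule: less_induct)
    case (less i)
    show ?case
    proof (cases "i \<le> 1")
      case True
      then show ?thesis
        by (cases i) auto
    next
      case False
      then obtain j where j: "i = Suc (Suc j)"
        by (metis One_nat_def Suc_le_mono le0 not0_implies_Suc)
      have "q (Suc (Suc j)) - q (Suc j) = q (Suc j) - q j"
        using step[of j] step[of "Suc j"] turn[of j] less.prems j by linarith
      then show ?thesis
        using less.IH[of j] less.IH[of "Suc j"] less.prems j by (simp add: algebra_simps)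
    qed
  qed
  have "\<bar>q (length p - 1) - q 0\<bar> = int (length p - 1) * \<bar>q 1 - q 0\<bar>"
    using straight[of "length p - 1"] ne by (simp add: abs_mult)
  also have "\<dots> = int (length p - 1)"
    using step[of 0] p(2) by (simp add: abs_minus_commute)
  finally show False
    using edge[OF p(3)] p(2) ne by (simp add: q_def hd_conv_nth last_conv_nth)
qed

text \<open>Shows that the minimum in \<open>mst_weight\<close> ranges over a nonempty set.\<close>

lemma spanning_tree_path_pairs:
  assumes "sorted_wrt (<) xs"
  shows "spanning_tree (set xs) (line_graph xs (path_pairs (length xs)))"
proof -
  let ?E = "line_graph xs (path_pairs (length xs))"
  have "\<exists>p. graph_path ?E p \<and> hd p = x \<and> last p = y" if xy: "x \<in> set xs" "y \<in> set xs" for x y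
  proof (cases "x = y")
    case True
    then show ?thesis
      by (intro exI[of _ "[x]"]) (simp add: graph_path_def)
  next
    case False
    have "\<exists>l\<le>length xs. (u, v) \<in> path_pairs (length xs) ^^ l" if "u < v" "v < length xs" for u v
      using relpow_path_pairs[of v "length xs" u] that by (intro exI[of _ "v - u"]) auto
    from spanner_path_between[OF assms path_pairs_ordered this xy False] show ?thesis
      by (auto simp: spanner_path_def)
  qed
  then show ?thesis
    using simple_line_graph[OF assms path_pairs_ordered] acyclic_path_pairs[OF assms]
    by (auto simp: spanning_tree_def graph_connected_def)
qed

text \<open>The weight of the minimum spanning tree is the denominator of the lightness, so a lower
  bound is the useful direction.\<close>

lemma mst_weight_ge:
  assumes "sorted_wrt (<) xs" "xs \<noteq> []"
  shows "xs ! (length xs - 1) - xs ! 0 \<le> mst_weight (set xs)"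
proof -
  have "{T. spanning_tree (set xs) T} \<subseteq> Pow (Pow (set xs))"
    unfolding spanning_tree_def simple_graph_def by auto
  then have "finite {T. spanning_tree (set xs) T}"
    by (rule finite_subset) simp
  moreover have "{T. spanning_tree (set xs) T} \<noteq> {}"
    using spanning_tree_path_pairs[OF assms(1)] by blast
  moreover have "xs ! (length xs - 1) - xs ! 0 \<le> graph_weight T" if "spanning_tree (set xs) T" for T
    using connected_graph_weight_ge[of "set xs" T "xs ! (length xs - 1)" "xs ! 0"] that assms(2)
    by (auto simp: spanning_tree_def)
  ultimately show ?thesis
    by (simp add: mst_weight_def)
qed

section \<open>Planar drawing by parabolic arcs\<close>

text \<open>
  The arc from \<open>a\<close> to \<open>b\<close> is the graph of \<open>(x - a) (b - x)\<close>, which strictly increases at every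
  interior point when the interval \<open>[a, b]\<close> grows.
\<close>

definition parabola :: "real \<Rightarrow> real \<Rightarrow> real \<Rightarrow> complex" where
  "parabola a b t = Complex (a + t * (b - a)) ((b - a)\<^sup>2 * (t * (1 - t)))"

lemma arc_parabola:
  assumes "a \<noteq> b"
  shows "arc (parabola a b)"
  unfolding arc_def path_def
proof
  show "continuous_on {0..1} (parabola a b)"
    unfolding parabola_def Complex_eq by (intro continuous_intros)
  show "inj_on (parabola a b) {0..1}"
    using assms by (auto simp: parabola_def inj_on_def)
qed

lemma parabola_ends: "pathstart (parabola a b) = of_real a" "pathfinish (parabola a b) = of_real b"
  by (simp_all add: parabola_def pathstart_def pathfinish_def complex_of_real_def)

lemma path_image_parabola:
  assumes "a < b"
  shows "path_image (parabola a b) = {Complex x ((x - a) * (b - x)) | x. a \<le> x \<and> x \<le> b}"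
    (is "_ = ?R")
proof
  show "path_image (parabola a b) \<subseteq> ?R"
  proof
    fix z assume "z \<in> path_image (parabola a b)"
    then obtain t where t: "0 \<le> t" "t \<le> 1" "z = parabola a b t"
      by (auto simp: path_image_def)
    let ?x = "a + t * (b - a)"
    have "t * (b - a) \<le> 1 * (b - a)" "0 \<le> t * (b - a)"
      using t assms by (intro mult_right_mono mult_nonneg_nonneg; simp)+
    moreover have "(?x - a) * (b - ?x) = (b - a)\<^sup>2 * (t * (1 - t))"
      by algebra
    ultimately show "z \<in> ?R"
      using t(3) unfolding parabola_def by (intro CollectI exI[of _ ?x]) auto
  qed
  show "?R \<subseteq> path_image (parabola a b)"
  proof
    fix z assume "z \<in> ?R"
    then obtain x where x: "a \<le> x" "x \<le> b" "z = Complex x ((x - a) * (b - x))"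
      by auto
    define t where "t = (x - a) / (b - a)"
    have t: "t * (b - a) = x - a" "(1 - t) * (b - a) = b - x" "0 \<le> t" "t \<le> 1"
      using assms x unfolding t_def by (auto simp: field_simps)
    have "(b - a)\<^sup>2 * (t * (1 - t)) = (t * (b - a)) * ((1 - t) * (b - a))"
      by (simp add: power2_eq_square mult_ac)
    then have "z = parabola a b t"
      using t by (simp add: parabola_def x(3))
    then show "z \<in> path_image (parabola a b)"
      using t by (auto simp: path_image_def)
  qed
qed

text \<open>Off the real axis all four factors are positive, and passing from \<open>[c, d]\<close>
  to \<open>[a, b]\<close> decreases neither factor and strictly increases one. So a common point
  has height zero, at an end of both intervals.\<close>

lemma nested_parabolas_meet:
  fixes a b c d x :: real
  assumes "a \<le> c" "c \<le> x" "x \<le> d" "d \<le> b" "(a, b) \<noteq> (c, d)"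
    and eq: "(x - a) * (b - x) = (x - c) * (d - x)"
  shows "x \<in> {a, b} \<inter> {c, d}"
proof (cases "(x - a) * (b - x) = 0")
  case True
  then show ?thesis
    using eq by auto
next
  case False
  then have pos: "0 < x - a" "0 < b - x" "0 < x - c" "0 < d - x"
    using assms by auto
  have "(x - c) * (d - x) < (x - a) * (b - x)"
  proof (cases "a < c")
    case True
    have "(x - c) * (d - x) \<le> (x - c) * (b - x)"
      using assms pos by (intro mult_left_mono) auto
    also have "\<dots> < (x - a) * (b - x)"
      using True pos by (intro mult_strict_right_mono) auto
    finally show ?thesis .
  next
    case False
    then have "(x - c) * (d - x) < (x - c) * (b - x)"
      using assms pos by (intro mult_strict_left_mono) auto
    also have "\<dots> \<le> (x - a) * (b - x)"
      using assms pos by (intro mult_right_mono) auto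
    finally show ?thesis .
  qed
  then show ?thesis
    using eq by simp
qed

text \<open>Intervals that are disjoint up to their ends share at most one abscissa; nested ones
  fall under \<open>nested_parabolas_meet\<close>. Either way the common points lie on the real
  axis.\<close>

lemma parabolas_meet:
  assumes "a < b" "c < d" "(a, b) \<noteq> (c, d)"
    and "b \<le> c \<or> d \<le> a \<or> a \<le> c \<and> d \<le> b \<or> c \<le> a \<and> b \<le> d"
  shows "path_image (parabola a b) \<inter> path_image (parabola c d) = of_real ` ({a, b} \<inter> {c, d})"
proof
  have ends: "x \<in> {a, b} \<inter> {c, d}"
    if x: "a \<le> x" "x \<le> b" "c \<le> x" "x \<le> d" "(x - a) * (b - x) = (x - c) * (d - x)" for x
  proof -
    consider "b \<le> c" | "d \<le> a" | "a \<le> c" "d \<le> b" | "c \<le> a" "b \<le> d"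
      using assms(4) by blast
    then show ?thesis
      using nested_parabolas_meet[of a c x d b] nested_parabolas_meet[of c a x b d] x assms(1-3)
      by cases auto
  qed
  show "path_image (parabola a b) \<inter> path_image (parabola c d) \<subseteq> of_real ` ({a, b} \<inter> {c, d})"
  proof
    fix z assume "z \<in> path_image (parabola a b) \<inter> path_image (parabola c d)"
    then obtain x where x: "a \<le> x" "x \<le> b" "c \<le> x" "x \<le> d" "(x - a) * (b - x) = (x - c) * (d - x)"
      and z: "z = Complex x ((x - a) * (b - x))"
      unfolding path_image_parabola[OF assms(1)] path_image_parabola[OF assms(2)] by auto
    have "x \<in> {a, b} \<inter> {c, d}"
      using ends x by blast
    moreover from this have "(x - a) * (b - x) = 0"
      by auto
    then have "z = of_real x"
      by (simp add: z complex_of_real_def)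
    ultimately show "z \<in> of_real ` ({a, b} \<inter> {c, d})"
      by (intro image_eqI)
  qed
  show "of_real ` ({a, b} \<inter> {c, d}) \<subseteq> path_image (parabola a b) \<inter> path_image (parabola c d)"
    unfolding path_image_parabola[OF assms(1)] path_image_parabola[OF assms(2)]
    using assms by (auto simp: complex_of_real_def)
qed

text \<open>Points lie on the real axis and edges are drawn above it. Sortedness turns the order of
  positions into that of coordinates, and an arc has height zero only at its ends, hence avoids all
  other points.\<close>

lemma planar_line_graph:
  assumes sorted: "sorted_wrt (<) xs"
    and ordered: "\<And>u v. (u, v) \<in> F \<Longrightarrow> u < v \<and> v < length xs"
    and noncrossing: "\<And>u v u' v'. (u, v) \<in> F \<Longrightarrow> (u', v') \<in> F \<Longrightarrow>
      v \<le> u' \<or> v' \<le> u \<or> u \<le> u' \<and> v' \<le> v \<or> u' \<le> u \<and> v \<le> v'"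
  shows "planar_graph (set xs) (line_graph xs F)"
proof -
  let ?E = "line_graph xs F" and ?pos = "of_real :: real \<Rightarrow> complex"
  note less_iff = nth_less_iff[OF sorted ordered] and le_iff = nth_le_iff[OF sorted ordered]
  \<comment> \<open>An edge is an unordered set, so the ends of its arc are recovered as
    \<open>Min\<close> and \<open>Max\<close>.\<close>
  define curve where "curve e = parabola (Min e) (Max e)" for e :: "real set"
  have edge: "\<exists>u v. (u, v) \<in> F \<and> e = {xs ! u, xs ! v} \<and> xs ! u < xs ! v \<and> curve e = parabola (xs ! u) (xs ! v)"
    if "e \<in> ?E" for e
  proof -
    obtain u v where uv: "(u, v) \<in> F" "e = {xs ! u, xs ! v}"
      using \<open>e \<in> ?E\<close> by (auto simp: line_graph_def)
    then have "xs ! u < xs ! v"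
      using ordered[OF uv(1)] less_iff by simp
    then show ?thesis
      using uv by (intro exI[of _ u] exI[of _ v]) (simp add: curve_def)
  qed
  show ?thesis
    unfolding planar_graph_def
  proof (intro conjI exI[of _ ?pos] exI[of _ curve] ballI impI)
    show "simple_graph (set xs) ?E"
      by (rule simple_line_graph[OF sorted ordered])
    show "inj_on ?pos (set xs)"
      by (auto simp: inj_on_def)
  next
    fix e assume "e \<in> ?E"
    then obtain u v where uv: "(u, v) \<in> F" "e = {xs ! u, xs ! v}" "xs ! u < xs ! v"
        "curve e = parabola (xs ! u) (xs ! v)"
      using edge by blast
    then show "arc (curve e)"
      using arc_parabola by simp
    show "{pathstart (curve e), pathfinish (curve e)} = ?pos ` e"
      unfolding uv(4) parabola_ends by (simp add: uv(2))
    have "u < length xs" "v < length xs"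
      using ordered[OF uv(1)] by auto
    then show "path_image (curve e) \<inter> ?pos ` set xs = ?pos ` e"
      unfolding uv(4) path_image_parabola[OF uv(3)]
      unfolding uv(2)
      using uv(3) by (auto simp: complex_of_real_def)
  next
    fix e f assume ef: "e \<in> ?E" "f \<in> ?E" "e \<noteq> f"
    obtain u v where uv: "(u, v) \<in> F" "e = {xs ! u, xs ! v}" "xs ! u < xs ! v"
        "curve e = parabola (xs ! u) (xs ! v)"
      using edge ef by blast
    obtain u' v' where uv': "(u', v') \<in> F" "f = {xs ! u', xs ! v'}" "xs ! u' < xs ! v'"
        "curve f = parabola (xs ! u') (xs ! v')"
      using edge ef by blast
    have "u < length xs" "v < length xs" "u' < length xs" "v' < length xs"
      using ordered[OF uv(1)] ordered[OF uv'(1)] by auto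
    then have "xs ! v \<le> xs ! u' \<or> xs ! v' \<le> xs ! u \<or> xs ! u \<le> xs ! u' \<and> xs ! v' \<le> xs ! v \<or>
        xs ! u' \<le> xs ! u \<and> xs ! v \<le> xs ! v'"
      using noncrossing[OF uv(1) uv'(1)] le_iff by simp
    then show "path_image (curve e) \<inter> path_image (curve f) = ?pos ` (e \<inter> f)"
      unfolding uv(4) uv'(4) using ef(3) uv uv' by (subst parabolas_meet) auto
  qed
qed

section \<open>Running the machine\<close>

definition reaches :: "nat \<Rightarrow> ram_program \<Rightarrow> nat \<Rightarrow> ram_config \<Rightarrow> ram_config \<Rightarrow> bool" where
  "reaches b P t c c' \<longleftrightarrow> (\<exists>s\<le>t. ram_run b P s c = Some c')"

lemma reaches_eq: "c = c' \<Longrightarrow> reaches b P t c c'"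
  unfolding reaches_def by (intro exI[of _ 0]) simp

text \<open>Rule for symbolic execution: each use runs one instruction and spends one unit of the
  budget \<open>t\<close>.\<close>

lemma reaches_step:
  assumes "0 < t" "pc < length P" "ram_exec b (P ! pc) (pc, W, R) = Some c" "reaches b P (t - 1) c c'"
  shows "reaches b P t (pc, W, R) c'"
proof -
  obtain s where "s \<le> t - 1" "ram_run b P s c = Some c'"
    using assms(4) by (auto simp: reaches_def)
  then show ?thesis
    unfolding reaches_def using assms by (intro exI[of _ "Suc s"]) auto
qed

lemma ram_run_add:
  "ram_run b P s c = Some c' \<Longrightarrow> ram_run b P (s + t) c = ram_run b P t c'"
proof (induction s arbitrary: c)
  case (Suc s)
  show ?case
  proof (cases "fst c < length P")
    case True
    then obtain d where "ram_exec b (P ! fst c) c = Some d" "ram_run b P s d = Some c'"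
      using Suc.prems by (auto simp: bind_eq_Some_conv)
    then show ?thesis
      using True Suc.IH by simp
  next
    case False
    then have "c' = c" "ram_run b P t c = Some c"
      using Suc.prems by (cases t; simp)+
    then show ?thesis
      using False by simp
  qed
qed simp

lemma reaches_trans:
  assumes "reaches b P s c d" "reaches b P t d e"
  shows "reaches b P (s + t) c e"
proof -
  obtain s' t' where "s' \<le> s" "ram_run b P s' c = Some d" "t' \<le> t" "ram_run b P t' d = Some e"
    using assms by (auto simp: reaches_def)
  then show ?thesis
    unfolding reaches_def by (intro exI[of _ "s' + t'"]) (auto simp: ram_run_add)
qed

lemma reaches_mono: "reaches b P s c d \<Longrightarrow> s \<le> t \<Longrightarrow> reaches b P t c d"
  unfolding reaches_def by (meson order_trans)

text \<open>A halted configuration is a fixed point, which turns at most \<open>t\<close> steps into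
  exactly \<open>t\<close> steps, as \<open>ram_run\<close> counts them.\<close>

lemma reaches_halted:
  assumes "reaches b P t c d" "length P \<le> fst d"
  shows "ram_run b P t c = Some d"
proof -
  obtain s where s: "s \<le> t" "ram_run b P s c = Some d"
    using assms(1) by (auto simp: reaches_def)
  have "ram_run b P (t - s) d = Some d"
    using assms(2) by (cases "t - s") auto
  then show ?thesis
    using ram_run_add[OF s(2), of "t - s"] s(1) by simp
qed

section \<open>The program and the symbolic execution of its loops\<close>

text \<open>
  Words \<open>2\<close>, \<open>3\<close> and \<open>4\<close> hold the current position \<open>p\<close>, the address \<open>32 + 2 l\<close> of the current level
  \<open>l\<close> and the output pointer; words \<open>5\<close>, \<open>12\<close> and \<open>14\<close> the constants \<open>1\<close>, \<open>2\<close> and \<open>34\<close>. For each level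
  \<open>j\<close>, word \<open>32 + 2 j\<close> is the block size and word \<open>33 + 2 j\<close> the start of the open block. From address
  \<open>40 + 2 n\<close> on, every position \<open>p \<ge> 1\<close> contributes the two edges \<open>(p - 1, p)\<close> and \<open>(s, p)\<close>, where \<open>s\<close>
  is the start of the block closed by \<open>p\<close>, or \<open>p - 1\<close> again if there is none. Instructions \<open>5\<close> to
  \<open>11\<close> compute the block sizes, \<open>21\<close> to \<open>46\<close> are the sweep.
\<close>

definition spanner_program :: ram_program where
  "spanner_program =
    [WConst 5 1,
     WConst 3 32,
     WConst 6 1,
     WConst 12 2,
     WStore 3 6,
     JumpWLess 6 0 7,
     Jump 12,
     WArith WTimes 6 6 1,
     WArith WPlus 6 6 12,
     WArith WPlus 3 3 12,
     WStore 3 6,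
     Jump 5,
     WArith WPlus 7 3 5,
     WConst 13 0,
     WStore 7 13,
     WConst 4 40,
     WArith WPlus 4 4 0,
     WArith WPlus 4 4 0,
     WConst 14 34,
     WMove 2 5,
     WMove 15 4,
     JumpWLess 2 0 23,
     Jump 47,
     WArith WMinus 6 2 5,
     WStore 4 6,
     WArith WPlus 4 4 5,
     WStore 4 2,
     WArith WPlus 4 4 5,
     WLoad 9 3,
     WArith WPlus 7 3 5,
     WLoad 10 7,
     WArith WPlus 11 10 9,
     WArith WMinus 11 11 5,
     JumpWEq 11 2 40,
     WStore 4 6,
     JumpWEq 3 14 42,
     WArith WMinus 3 3 12,
     WArith WMinus 7 7 12,
     WStore 7 2,
     Jump 42,
     WStore 4 10,
     WArith WPlus 3 3 12,
     WArith WPlus 4 4 5,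
     WStore 4 2,
     WArith WPlus 4 4 5,
     WArith WPlus 2 2 5,
     Jump 21,
     WArith WMinus 0 0 5,
     WArith WPlus 0 0 0,
     WMove 1 15]"

lemma spanner_program_nth:
  "spanner_program ! (0) = WConst 5 1"
  "spanner_program ! (Suc 0) = WConst 3 32"
  "spanner_program ! (2) = WConst 6 1"
  "spanner_program ! (3) = WConst 12 2"
  "spanner_program ! (4) = WStore 3 6"
  "spanner_program ! (5) = JumpWLess 6 0 7"
  "spanner_program ! (6) = Jump 12"
  "spanner_program ! (7) = WArith WTimes 6 6 1"
  "spanner_program ! (8) = WArith WPlus 6 6 12"
  "spanner_program ! (9) = WArith WPlus 3 3 12"
  "spanner_program ! (10) = WStore 3 6"
  "spanner_program ! (11) = Jump 5"
  "spanner_program ! (12) = WArith WPlus 7 3 5"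
  "spanner_program ! (13) = WConst 13 0"
  "spanner_program ! (14) = WStore 7 13"
  "spanner_program ! (15) = WConst 4 40"
  "spanner_program ! (16) = WArith WPlus 4 4 0"
  "spanner_program ! (17) = WArith WPlus 4 4 0"
  "spanner_program ! (18) = WConst 14 34"
  "spanner_program ! (19) = WMove 2 5"
  "spanner_program ! (20) = WMove 15 4"
  "spanner_program ! (21) = JumpWLess 2 0 23"
  "spanner_program ! (22) = Jump 47"
  "spanner_program ! (23) = WArith WMinus 6 2 5"
  "spanner_program ! (24) = WStore 4 6"
  "spanner_program ! (25) = WArith WPlus 4 4 5"
  "spanner_program ! (26) = WStore 4 2"
  "spanner_program ! (27) = WArith WPlus 4 4 5"
  "spanner_program ! (28) = WLoad 9 3"
  "spanner_program ! (29) = WArith WPlus 7 3 5"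
  "spanner_program ! (30) = WLoad 10 7"
  "spanner_program ! (31) = WArith WPlus 11 10 9"
  "spanner_program ! (32) = WArith WMinus 11 11 5"
  "spanner_program ! (33) = JumpWEq 11 2 40"
  "spanner_program ! (34) = WStore 4 6"
  "spanner_program ! (35) = JumpWEq 3 14 42"
  "spanner_program ! (36) = WArith WMinus 3 3 12"
  "spanner_program ! (37) = WArith WMinus 7 7 12"
  "spanner_program ! (38) = WStore 7 2"
  "spanner_program ! (39) = Jump 42"
  "spanner_program ! (40) = WStore 4 10"
  "spanner_program ! (41) = WArith WPlus 3 3 12"
  "spanner_program ! (42) = WArith WPlus 4 4 5"
  "spanner_program ! (43) = WStore 4 2"
  "spanner_program ! (44) = WArith WPlus 4 4 5"
  "spanner_program ! (45) = WArith WPlus 2 2 5"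
  "spanner_program ! (46) = Jump 21"
  "spanner_program ! (47) = WArith WMinus 0 0 5"
  "spanner_program ! (48) = WArith WPlus 0 0 0"
  "spanner_program ! (49) = WMove 1 15"
  by (simp_all add: spanner_program_def)

lemma length_spanner_program: "length spanner_program = 50"
  by (simp add: spanner_program_def)

lemmas exec_simps = spanner_program_nth length_spanner_program put_word_def jump_if_def

lemma size_loop_step:
  assumes "W 0 = n" "W (Suc 0) = k" "W 3 = 32 + 2 * j" "W 5 = 1" "W 6 = s" "W 12 = 2"
    and "s < n" "k \<le> n" "j \<le> n" "n * n + 100 * n < b" "2 \<le> n"
  shows "reaches b spanner_program 6 (5, W, R)
    (5, W(6 := k * s + 2, 3 := 34 + 2 * j, 34 + 2 * j := k * s + 2), R)"
proof -
  \<comment> \<open>A new size is computed only while \<open>s < n\<close>, so products are at most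
    \<open>n * n\<close> and fit in a word.\<close>
  have "s * k \<le> n * n"
    using assms by (intro mult_le_mono) auto
  then have bounds: "s * k < b" "Suc (Suc (s * k)) < b" "34 + 2 * j < b"
    using assms by linarith+
  show ?thesis
    apply (rule reaches_step, simp, simp add: exec_simps, simp add: exec_simps assms bounds)+
    apply (rule reaches_eq, simp add: mult.commute)
    done
qed

text \<open>Storing \<open>0\<close> at \<open>33 + 2 * j\<close> opens the top block at position
  \<open>0\<close>; the sweep therefore starts at position \<open>1\<close>.\<close>

lemma size_loop_exit:
  assumes "W 0 = n" "W 3 = 32 + 2 * j" "W 5 = 1" "W 6 = s"
    and "\<not> s < n" "j \<le> n" "n * n + 100 * n < b" "2 \<le> n"
  shows "reaches b spanner_program 11 (5, W, R)
    (21, W(7 := 33 + 2 * j, 13 := 0, 33 + 2 * j := 0, 4 := 40 + 2 * n, 14 := 34, 2 := 1,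
      15 := 40 + 2 * n), R)"
proof -
  have bounds: "0 < b" "40 < b" "34 < b" "Suc 0 < b" "40 + n < b" "2 * n + 40 < b" "33 + 2 * j < b"
    using assms by linarith+
  show ?thesis
    apply (rule reaches_step, simp, simp add: exec_simps, simp add: exec_simps assms bounds)+
    apply (rule reaches_eq, simp add: add.commute)
    done
qed

context
  fixes W :: "nat \<Rightarrow> nat" and n p l r s a b :: nat
  assumes W: "W 0 = n" "W 2 = p" "W 3 = 32 + 2 * l" "W 4 = r" "W 5 = 1" "W 12 = 2" "W 14 = 34"
    "W (32 + 2 * l) = s" "W (33 + 2 * l) = a"
  assumes bounds: "p < n" "1 \<le> l" "l \<le> n" "0 < s" "s \<le> n * n" "a < n" "40 + 2 * n \<le> r"
    "r + 8 < b" "n * n + 100 * n < b"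
begin

lemma less_word_bound:
  "p < b" "p - 1 < b" "p - Suc 0 < b" "Suc p < b"
  "Suc r < b" "Suc (Suc r) < b" "Suc (Suc (Suc r)) < b" "Suc (Suc (Suc (Suc r))) < b"
  "a < b" "s < b" "a + s < b" "a + s - Suc 0 < b"
  "30 + 2 * l < b" "31 + 2 * l < b" "33 + 2 * l < b" "35 < b" "34 + 2 * l < b"
  using bounds by linarith+

text \<open>The output pointer \<open>r\<close> lies beyond the level table, whose addresses reach
  at most \<open>33 + 2 * n\<close>, so stores to one never alter the other.\<close>

lemma address_neq:
  "x < 40 + 2 * n \<Longrightarrow> r \<noteq> x" "x < 40 + 2 * n \<Longrightarrow> x \<noteq> r"
  "28 + 2 * l \<noteq> r" "29 + 2 * l \<noteq> r" "30 + 2 * l \<noteq> r" "31 + 2 * l \<noteq> r" "32 + 2 * l \<noteq> r" "33 + 2 * l \<noteq> r"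
  "r \<noteq> 28 + 2 * l" "r \<noteq> 29 + 2 * l" "r \<noteq> 30 + 2 * l" "r \<noteq> 31 + 2 * l" "r \<noteq> 32 + 2 * l" "r \<noteq> 33 + 2 * l"
  using bounds by linarith+

text \<open>The address \<open>34 + 2 * l\<close> returns to the parent level. The final memory is
  given by the values of interest and a frame condition, which leaves the scratch registers
  open.\<close>

lemma sweep_close:
  assumes "a + s - Suc 0 = p"
  shows "\<exists>W'. reaches b spanner_program 19 (21, W, R) (21, W', R) \<and>
       W' 2 = Suc p \<and> W' 3 = 34 + 2 * l \<and> W' 4 = r + 4 \<and>
       W' r = p - 1 \<and> W' (r + 1) = p \<and> W' (r + 2) = a \<and> W' (r + 3) = p \<and>
       (\<forall>x. (32 \<le> x \<or> x \<in> {0, 5, 12, 14, 15}) \<and> x \<notin> {r, r + 1, r + 2, r + 3} \<longrightarrow> W' x = W x)"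
  apply (intro exI conjI)
  apply (rule reaches_step, simp, simp add: exec_simps,
      simp add: exec_simps W less_word_bound bounds address_neq assms)+
  apply (rule reaches_eq, rule refl, auto simp: W less_word_bound bounds address_neq assms)
  done

lemma sweep_leaf:
  assumes "a + s - Suc 0 \<noteq> p" "l = Suc 0"
  shows "\<exists>W'. reaches b spanner_program 19 (21, W, R) (21, W', R) \<and>
       W' 2 = Suc p \<and> W' 3 = 32 + 2 * l \<and> W' 4 = r + 4 \<and>
       W' r = p - 1 \<and> W' (r + 1) = p \<and> W' (r + 2) = p - 1 \<and> W' (r + 3) = p \<and>
       (\<forall>x. (32 \<le> x \<or> x \<in> {0, 5, 12, 14, 15}) \<and> x \<notin> {r, r + 1, r + 2, r + 3} \<longrightarrow> W' x = W x)"
proof -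
  have W_level_1: "W 34 = s" "W 35 = a"
    using W assms(2) by simp_all
  show ?thesis
    apply (intro exI conjI)
    apply (rule reaches_step, simp, simp add: exec_simps,
        simp add: exec_simps W less_word_bound bounds address_neq assms W_level_1)+
    apply (rule reaches_eq, rule refl, auto simp: W less_word_bound bounds address_neq assms W_level_1)
    done
qed

text \<open>Position \<open>p\<close> opens a block of level \<open>l - 1\<close>; its start goes to
  \<open>31 + 2 * l\<close>, which is \<open>33 + 2 * (l - 1)\<close>.\<close>

lemma sweep_open:
  assumes "a + s - Suc 0 \<noteq> p" "l \<noteq> Suc 0"
  shows "\<exists>W'. reaches b spanner_program 23 (21, W, R) (21, W', R) \<and>
       W' 2 = Suc p \<and> W' 3 = 30 + 2 * l \<and> W' 4 = r + 4 \<and>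
       W' r = p - 1 \<and> W' (r + 1) = p \<and> W' (r + 2) = p - 1 \<and> W' (r + 3) = p \<and>
       W' (31 + 2 * l) = p \<and>
       (\<forall>x. (32 \<le> x \<or> x \<in> {0, 5, 12, 14, 15}) \<and> x \<notin> {r, r + 1, r + 2, r + 3, 31 + 2 * l} \<longrightarrow> W' x = W x)"
  apply (intro exI conjI)
  apply (rule reaches_step, simp, simp add: exec_simps,
      simp add: exec_simps W less_word_bound bounds address_neq assms)+
  apply (rule reaches_eq, rule refl, auto simp: W less_word_bound bounds address_neq assms)
  done

end

text \<open>Each of the \<open>n - 1\<close> positions after the first has contributed two edges;
  word \<open>15\<close> keeps the address of the first edge.\<close>

lemma sweep_exit:
  assumes "W 0 = n" "W 2 = n" "W 5 = 1" "W 15 = r" "r < b" "2 * n < b"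
  shows "reaches b spanner_program 5 (21, W, R) (50, W(0 := 2 * (n - 1), 1 := r), R)"
proof -
  have bounds: "n - Suc 0 < b" "n - Suc 0 + (n - Suc 0) < b"
    using assms by linarith+
  show ?thesis
    apply (rule reaches_step, simp, simp add: exec_simps, simp add: exec_simps assms bounds)+
    apply (rule reaches_eq, simp add: mult_2)
    done
qed

lemma initialize:
  assumes "40 < b"
  shows "reaches b spanner_program 5 (0, W, R)
    (5, W(5 := 1, 3 := 32, 6 := 1, 12 := 2, 32 := 1), R)"
  using assms
  apply -
  apply (rule reaches_step, simp, simp add: exec_simps, simp add: exec_simps spanner_program_def)+
  apply (rule reaches_eq, simp)
  done

section \<open>The sweep\<close>

text \<open>
  Just before the sweep reaches position \<open>p\<close>, \<open>l\<close> is the lowest level with an open block, and \<open>st j\<close>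
  is the start of the open block of level \<open>j\<close>.
\<close>

definition nest :: "nat \<Rightarrow> nat \<Rightarrow> nat \<Rightarrow> (nat \<Rightarrow> nat) \<Rightarrow> nat \<Rightarrow> bool" where
  "nest k J l st p \<longleftrightarrow> 1 \<le> l \<and> l \<le> J \<and>
     (\<forall>j. l \<le> j \<and> j \<le> J \<longrightarrow> blocks k j (st j) \<subseteq> blocks k J 0) \<and>
     (\<forall>j. l \<le> j \<and> j < J \<longrightarrow> (\<exists>i<k. st j = st (Suc j) + 1 + i * bsize k j)) \<and>
     (st J = 0) \<and>
     (\<exists>i\<le>k. p = st l + 1 + i * bsize k (l - 1))"

lemma nest_cong:
  assumes "nest k J l st p" "\<And>j. l \<le> j \<Longrightarrow> j \<le> J \<Longrightarrow> st' j = st j"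
  shows "nest k J l st' p"
  using assms unfolding nest_def by simp

lemma nest_start: "1 \<le> J \<Longrightarrow> st J = 0 \<Longrightarrow> nest k J J st 1"
  by (auto simp: nest_def)

lemma nest_bounds:
  assumes "nest k J l st p"
  shows "st l < p" "1 \<le> l" "l \<le> J"
  using assms by (auto simp: nest_def)

text \<open>With \<open>i\<close> children of the current block behind it, \<open>p\<close> is the
  closing position if \<open>i = k\<close> and the start of child \<open>i\<close>
  otherwise.\<close>

lemma nest_position:
  assumes "nest k J l st p"
  obtains "p = st l + bsize k l - 1"
  | i where "i < k" "p = st l + 1 + i * bsize k (l - 1)" "p < st l + bsize k l - 1"
proof -
  obtain i where i: "i \<le> k" "p = st l + 1 + i * bsize k (l - 1)" and l: "1 \<le> l"
    using assms by (auto simp: nest_def)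
  have size: "bsize k l = k * bsize k (l - 1) + 2"
    using l by (cases l) auto
  show thesis
  proof (cases "i = k")
    case True
    then show ?thesis
      using that(1) i(2) size by simp
  next
    case False
    then have "i * bsize k (l - 1) < k * bsize k (l - 1)"
      using i(1) bsize_pos by simp
    then show ?thesis
      using that(2)[of i] False i size by simp
  qed
qed

lemma nest_block_root:
  assumes "nest k J l st p"
  shows "(st l, st l + bsize k l - 1) \<in> blocks k J 0"
  using assms blocks_root[of "st l" k l] by (auto simp: nest_def)

lemma nest_close:
  assumes "nest k J l st p" "p = st l + bsize k l - 1" "Suc p < bsize k J"
  shows "nest k J (Suc l) st (Suc p)"
proof -
  have "l \<noteq> J"
    using assms bsize_pos[of k l] by (auto simp: nest_def)
  then have "l < J"
    using assms(1) by (simp add: nest_def)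
  then obtain i where i: "i < k" "st l = st (Suc l) + 1 + i * bsize k l"
    using assms(1) by (auto simp: nest_def)
  \<comment> \<open>The closed block was child \<open>i\<close> of its parent, so next comes child
    \<open>Suc i\<close> or, if \<open>Suc i = k\<close>, the closing position of the
    parent.\<close>
  have "Suc p = st (Suc l) + 1 + Suc i * bsize k l"
    using i assms(2) bsize_pos[of k l] by simp
  then show ?thesis
    using assms(1) \<open>l < J\<close> i(1) unfolding nest_def by (auto intro!: exI[of _ "Suc i"])
qed

lemma nest_child:
  assumes "nest k J l st p" "i < k" "p = st l + 1 + i * bsize k (l - 1)"
  shows "blocks k (l - 1) p \<subseteq> blocks k J 0"
proof -
  obtain l' where "l = Suc l'"
    using assms(1) by (cases l) (auto simp: nest_def)
  then have "blocks k (l - 1) p \<subseteq> blocks k l (st l)"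
    using blocks_child[OF assms(2), of l' "st l"] assms(3) by simp
  then show ?thesis
    using assms(1) by (fastforce simp: nest_def)
qed

lemma nest_leaf:
  assumes "nest k J 1 st p" "i < k" "p = st 1 + 1 + i * bsize k (1 - 1)"
  shows "nest k J 1 st (Suc p)"
  using assms unfolding nest_def by (auto intro!: exI[of _ "Suc i"])

lemma nest_open:
  assumes "nest k J l st p" "i < k" "p = st l + 1 + i * bsize k (l - 1)" "l \<noteq> 1"
  shows "nest k J (l - 1) (st(l - 1 := p)) (Suc p)"
proof -
  obtain l' where l': "l = Suc l'" "1 \<le> l'"
    using assms(1,4) by (cases l) (auto simp: nest_def)
  note child = nest_child[OF assms(1-3)]
  show ?thesis
    using assms child l' unfolding nest_def
    by (auto simp: le_Suc_eq Suc_le_eq dest: le_neq_implies_less)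
qed

text \<open>Describes the second edge written for \<open>p\<close>. Repeating the path edge when
  \<open>p\<close> closes no block gives all positions records of equal length, and the duplicate
  vanishes in the set of edges.\<close>

definition partner :: "nat \<Rightarrow> nat \<Rightarrow> nat \<Rightarrow> nat \<Rightarrow> bool" where
  "partner k J p s \<longleftrightarrow>
     (if \<exists>u<p. (u, p) \<in> blocks k J 0 then s < p \<and> (s, p) \<in> blocks k J 0 else s = p - 1)"

lemma partner_close:
  assumes "nest k J l st p" "p = st l + bsize k l - 1"
  shows "partner k J p (st l)"
  using nest_block_root[OF assms(1)] nest_bounds[OF assms(1)] assms(2) by (auto simp: partner_def)

text \<open>
  Here \<open>p\<close> opens a block or is a leaf, and no position is an end of two blocks.
\<close>

lemma partner_other:
  assumes "nest k J l st p" "i < k" "p = st l + 1 + i * bsize k (l - 1)"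
  shows "partner k J p (p - 1)"
proof -
  have "(p, p + bsize k (l - 1) - 1) \<in> blocks k J 0"
    using nest_child[OF assms] blocks_root by blast
  then have "\<not> (\<exists>u<p. (u, p) \<in> blocks k J 0)"
    using blocks_endpoint_unique by (metis Int_iff empty_iff insertI1 insertI2 less_irrefl)
  then show ?thesis
    by (simp only: partner_def if_False)
qed

definition spanner_pairs :: "nat \<Rightarrow> nat \<Rightarrow> nat \<Rightarrow> (nat \<times> nat) set" where
  "spanner_pairs k J n = path_pairs n \<union> {(u, v) \<in> blocks k J 0. u < v \<and> v < n}"

section \<open>Invariants and running time of the program\<close>

lemma bsize_mono:
  assumes "1 \<le> k" "i \<le> j"
  shows "bsize k i \<le> bsize k j"
proof (rule lift_Suc_mono_le[OF _ assms(2)])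
  fix j
  have "1 * bsize k j \<le> k * bsize k j"
    using assms(1) by (rule mult_le_mono1)
  then show "bsize k j \<le> bsize k (Suc j)"
    unfolding bsize.simps by linarith
qed

text \<open>\<open>J\<close> is the least level with at least \<open>n\<close> positions. The word
  bound has room for block sizes up to \<open>n * n\<close> and for addresses linear in
  \<open>n\<close>.\<close>

locale spanner_run =
  fixes n k J b :: nat
  assumes k: "2 \<le> k" "k \<le> n"
    and J: "n \<le> bsize k J" "\<And>j. j < J \<Longrightarrow> bsize k j < n"
    and b: "n * n + 100 * n < b"
begin

lemma J_pos: "1 \<le> J"
  using J(1) k by (cases J) auto

text \<open>Keeps the level table below the output area and the computation of the sizes linear in
  \<open>n\<close>.\<close>

lemma J_less: "J \<le> n"
proof -
  obtain J' where J': "J = Suc J'"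
    using J_pos by (cases J) auto
  have "J' < bsize k J'"
    using k by (intro less_bsize) simp
  then show ?thesis
    using J(2)[of J'] J' by simp
qed

text \<open>Minimality of \<open>J\<close> gives \<open>bsize k (J - 1) + 1 \<le> n\<close>.
  Multiply by \<open>k \<le> n\<close>; since \<open>2 \<le> k\<close>, the product also covers the
  two extra positions.\<close>

lemma bsize_le_square: "j \<le> J \<Longrightarrow> bsize k j \<le> n * n"
proof -
  assume "j \<le> J"
  obtain J' where J': "J = Suc J'"
    using J_pos by (cases J) auto
  have "bsize k J' + 1 \<le> n"
    using J(2)[of J'] J' by simp
  then have "k * bsize k J' + k \<le> n * n"
    using mult_le_mono[of k n "bsize k J' + 1" n] k by (simp add: algebra_simps)
  then have "bsize k J \<le> n * n"
    using J' k by simp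
  then show ?thesis
    using bsize_mono[of k j J] \<open>j \<le> J\<close> k by linarith
qed

definition size_inv :: "nat \<Rightarrow> (nat \<Rightarrow> nat) \<Rightarrow> bool" where
  "size_inv j W \<longleftrightarrow> W 0 = n \<and> W (Suc 0) = k \<and> W 3 = 32 + 2 * j \<and> W 5 = 1 \<and> W 6 = bsize k j \<and>
     W 12 = 2 \<and> (\<forall>i\<le>j. W (32 + 2 * i) = bsize k i)"

lemma size_loop:
  "j \<le> J \<Longrightarrow> size_inv j W \<Longrightarrow>
    \<exists>W'. reaches b spanner_program (6 * (J - j)) (5, W, R) (5, W', R) \<and> size_inv J W'"
proof (induction "J - j" arbitrary: j W)
  case 0
  then have "j = J"
    by simp
  with 0 show ?case
    by (intro exI[of _ W]) (simp add: reaches_eq)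
next
  case (Suc d)
  then have j: "j < J" "6 * (J - j) = 6 + 6 * (J - Suc j)" "j \<le> n"
    using J_less by auto
  let ?W = "W(6 := k * bsize k j + 2, 3 := 34 + 2 * j, 34 + 2 * j := k * bsize k j + 2)"
  have "reaches b spanner_program 6 (5, W, R) (5, ?W, R)"
    using Suc.prems j J(2)[OF j(1)] k b by (intro size_loop_step[of W n]) (auto simp: size_inv_def)
  moreover have "size_inv (Suc j) ?W"
    using Suc.prems by (auto simp: size_inv_def le_Suc_eq)
  then obtain W' where "reaches b spanner_program (6 * (J - Suc j)) (5, ?W, R) (5, W', R)" "size_inv J W'"
    using Suc.hyps(1)[of "Suc j" ?W] Suc.hyps(2) j by fastforce
  ultimately show ?case
    unfolding j(2) using reaches_trans by blast
qed

text \<open>The record of position \<open>Suc i\<close> occupies four words from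
  \<open>40 + 2 * n + 4 * i\<close> on, hence the output pointer \<open>36 + 2 * n + 4 * p\<close>.
  The stack is required only for \<open>p < n\<close>, because the last position may close the top
  block and leave no block open.\<close>

definition sweep_inv :: "nat \<Rightarrow> (nat \<Rightarrow> nat) \<Rightarrow> bool" where
  "sweep_inv p W \<longleftrightarrow>
     W 0 = n \<and> W 2 = p \<and> W 4 = 36 + 2 * n + 4 * p \<and> W 5 = 1 \<and> W 12 = 2 \<and> W 14 = 34 \<and>
     W 15 = 40 + 2 * n \<and> (\<forall>j\<le>J. W (32 + 2 * j) = bsize k j) \<and>
     (\<forall>i. Suc i < p \<longrightarrow> W (40 + 2 * n + 4 * i) = i \<and> W (41 + 2 * n + 4 * i) = Suc i \<and>
        partner k J (Suc i) (W (42 + 2 * n + 4 * i)) \<and> W (43 + 2 * n + 4 * i) = Suc i) \<and>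
     (p < n \<longrightarrow> (\<exists>l. W 3 = 32 + 2 * l \<and> nest k J l (\<lambda>j. W (33 + 2 * j)) p))"

lemma sweep_start:
  assumes "size_inv J W"
  shows "\<exists>W'. reaches b spanner_program 11 (5, W, R) (21, W', R) \<and> sweep_inv 1 W'"
proof -
  let ?W = "W(7 := 33 + 2 * J, 13 := 0, 33 + 2 * J := 0, 4 := 40 + 2 * n, 14 := 34, 2 := 1,
      15 := 40 + 2 * n)"
  have "reaches b spanner_program 11 (5, W, R) (21, ?W, R)"
    using assms J(1) J_less k b by (intro size_loop_exit[of W n]) (auto simp: size_inv_def)
  moreover have odd_even: "32 + 2 * j \<noteq> 33 + 2 * i" for i j :: nat
    by presburger
  moreover have "nest k J J (\<lambda>j. ?W (33 + 2 * j)) 1"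
    using J_pos by (intro nest_start) auto
  then have "sweep_inv 1 ?W"
    using assms odd_even unfolding sweep_inv_def size_inv_def by auto
  ultimately show ?thesis
    by blast
qed

text \<open>Common to the three branches of the sweep. The frame condition exempts the starts of
  levels up to \<open>J\<close>, since opening a block overwrites one; the last premise accounts for
  them.\<close>

lemma sweep_inv_step:
  assumes "sweep_inv p W" "1 \<le> p" "p < n"
    and "W' 2 = Suc p" "W' 4 = 40 + 2 * n + 4 * p"
    and "W' (36 + 2 * n + 4 * p) = p - 1" "W' (37 + 2 * n + 4 * p) = p"
    and "partner k J p (W' (38 + 2 * n + 4 * p))" "W' (39 + 2 * n + 4 * p) = p"
    and frame: "\<And>x. 32 \<le> x \<or> x \<in> {0, 5, 12, 14, 15} \<Longrightarrow> x < 36 + 2 * n + 4 * p \<Longrightarrow>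
      (\<And>j. x \<noteq> 33 + 2 * j \<or> J < j) \<Longrightarrow> W' x = W x"
    and "Suc p < n \<Longrightarrow> \<exists>l. W' 3 = 32 + 2 * l \<and> nest k J l (\<lambda>j. W' (33 + 2 * j)) (Suc p)"
  shows "sweep_inv (Suc p) W'"
proof -
  have registers: "W' x = W x" if "x \<in> {0, 5, 12, 14, 15}" for x
    using that by (intro frame) auto
  have sizes: "W' (32 + 2 * j) = W (32 + 2 * j)" if "j \<le> J" for j
    using that J_less by (intro frame) (auto, presburger)
  have out: "W' (40 + 2 * n + x) = W (40 + 2 * n + x)" if "x + 4 < 4 * p" for x
    using that J_less by (intro frame) auto
  have old: "W (40 + 2 * n + 4 * i) = i \<and> W (41 + 2 * n + 4 * i) = Suc i \<and>
      partner k J (Suc i) (W (42 + 2 * n + 4 * i)) \<and> W (43 + 2 * n + 4 * i) = Suc i"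
    if "Suc i < p" for i
    using assms(1) that by (simp add: sweep_inv_def)
  have "W' (40 + 2 * n + 4 * i) = i \<and> W' (41 + 2 * n + 4 * i) = Suc i \<and>
      partner k J (Suc i) (W' (42 + 2 * n + 4 * i)) \<and> W' (43 + 2 * n + 4 * i) = Suc i"
    if "Suc i < Suc p" for i
  proof (cases "Suc i = p")
    case True
    then have "40 + 2 * n + 4 * i = 36 + 2 * n + 4 * p" "41 + 2 * n + 4 * i = 37 + 2 * n + 4 * p"
      "42 + 2 * n + 4 * i = 38 + 2 * n + 4 * p" "43 + 2 * n + 4 * i = 39 + 2 * n + 4 * p" "i = p - 1"
      by auto
    then show ?thesis
      using assms(6-9) True by metis
  next
    case False
    then show ?thesis
      using old[of i] out[of "4 * i"] out[of "4 * i + 1"] out[of "4 * i + 2"] out[of "4 * i + 3"] that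
      by (simp add: add_ac)
  qed
  then show ?thesis
    using assms registers sizes unfolding sweep_inv_def by simp
qed

text \<open>Opening a block is the longest branch and takes \<open>23\<close> instructions; the
  other two take \<open>19\<close>.\<close>

lemma sweep_step:
  assumes "sweep_inv p W" "1 \<le> p" "p < n"
  shows "\<exists>W'. reaches b spanner_program 23 (21, W, R) (21, W', R) \<and> sweep_inv (Suc p) W'"
proof -
  let ?r = "36 + 2 * n + 4 * p"
  obtain l where l: "W 3 = 32 + 2 * l" "nest k J l (\<lambda>j. W (33 + 2 * j)) p"
    using assms by (auto simp: sweep_inv_def)
  define a where "a = W (33 + 2 * l)"
  define s where "s = bsize k l"
  note nest = l(2)
  have l_bounds: "1 \<le> l" "l \<le> J" "l \<le> n" "a < p"
    using nest_bounds[OF nest] J_less by (auto simp: a_def)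
  have W: "W 0 = n" "W 2 = p" "W 3 = 32 + 2 * l" "W 4 = ?r" "W 5 = 1" "W 12 = 2" "W 14 = 34"
    "W (32 + 2 * l) = s" "W (33 + 2 * l) = a"
    using assms(1) l(1) l_bounds by (auto simp: sweep_inv_def a_def s_def)
  have bounds: "p < n" "1 \<le> l" "l \<le> n" "0 < s" "s \<le> n * n" "a < n" "40 + 2 * n \<le> ?r"
    "?r + 8 < b" "n * n + 100 * n < b"
    using assms l_bounds bsize_le_square[of l] bsize_pos[of k l] b k by (auto simp: s_def)
  note step = sweep_inv_step[OF assms]
  show ?thesis
  proof (cases rule: nest_position[OF nest])
    case 1
    then have "a + s - Suc 0 = p"
      by (simp add: a_def s_def)
    from sweep_close[OF W bounds this, of R]
    obtain W' where run: "reaches b spanner_program 19 (21, W, R) (21, W', R)"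
      and W': "W' 2 = Suc p" "W' 3 = 34 + 2 * l" "W' 4 = ?r + 4"
        "W' ?r = p - 1" "W' (?r + 1) = p" "W' (?r + 2) = a" "W' (?r + 3) = p"
      and frame: "\<And>x. 32 \<le> x \<or> x \<in> {0, 5, 12, 14, 15} \<Longrightarrow> x \<notin> {?r, ?r + 1, ?r + 2, ?r + 3} \<Longrightarrow> W' x = W x"
      by blast
    have "sweep_inv (Suc p) W'"
    proof (rule step)
      show "partner k J p (W' (38 + 2 * n + 4 * p))"
        using partner_close[OF nest 1] W'(6) by (simp add: a_def add_ac)
      show "\<exists>l. W' 3 = 32 + 2 * l \<and> nest k J l (\<lambda>j. W' (33 + 2 * j)) (Suc p)" if "Suc p < n"
      proof (intro exI conjI)
        show "W' 3 = 32 + 2 * Suc l"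
          using W' by simp
        have "nest k J (Suc l) (\<lambda>j. W (33 + 2 * j)) (Suc p)"
          using nest_close[OF nest 1] that J(1) by simp
        then show "nest k J (Suc l) (\<lambda>j. W' (33 + 2 * j)) (Suc p)"
          by (rule nest_cong) (use frame J_less assms in auto)
      qed
    qed (use W' frame in \<open>auto simp: add_ac\<close>)
    then show ?thesis
      using reaches_mono[OF run, of 23] by auto
  next
    case (2 i)
    then have not_close: "a + s - Suc 0 \<noteq> p"
      by (auto simp: a_def s_def)
    note partner = partner_other[OF nest 2(1,2)]
    show ?thesis
    proof (cases "l = Suc 0")
      case True
      from sweep_leaf[OF W bounds not_close this, of R]
      obtain W' where run: "reaches b spanner_program 19 (21, W, R) (21, W', R)"
        and W': "W' 2 = Suc p" "W' 3 = 32 + 2 * l" "W' 4 = ?r + 4"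
          "W' ?r = p - 1" "W' (?r + 1) = p" "W' (?r + 2) = p - 1" "W' (?r + 3) = p"
        and frame: "\<And>x. 32 \<le> x \<or> x \<in> {0, 5, 12, 14, 15} \<Longrightarrow> x \<notin> {?r, ?r + 1, ?r + 2, ?r + 3} \<Longrightarrow> W' x = W x"
        by blast
      have "sweep_inv (Suc p) W'"
      proof (rule step)
        show "partner k J p (W' (38 + 2 * n + 4 * p))"
          using partner W'(6) by (simp add: add_ac)
        have "nest k J l (\<lambda>j. W (33 + 2 * j)) (Suc p)"
          using nest_leaf[of k J "\<lambda>j. W (33 + 2 * j)" p i] nest 2 True by simp
        then have "nest k J l (\<lambda>j. W' (33 + 2 * j)) (Suc p)"
          by (rule nest_cong) (use frame J_less assms in auto)
        then show "\<exists>l. W' 3 = 32 + 2 * l \<and> nest k J l (\<lambda>j. W' (33 + 2 * j)) (Suc p)"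
          using W' by blast
      qed (use W' frame in \<open>auto simp: add_ac\<close>)
      then show ?thesis
        using reaches_mono[OF run, of 23] by auto
    next
      case False
      then have l1: "33 + 2 * (l - 1) = 31 + 2 * l" "30 + 2 * l = 32 + 2 * (l - 1)"
        using l_bounds by simp_all
      from sweep_open[OF W bounds not_close False, of R]
      obtain W' where run: "reaches b spanner_program 23 (21, W, R) (21, W', R)"
        and W': "W' 2 = Suc p" "W' 3 = 30 + 2 * l" "W' 4 = ?r + 4"
          "W' ?r = p - 1" "W' (?r + 1) = p" "W' (?r + 2) = p - 1" "W' (?r + 3) = p" "W' (31 + 2 * l) = p"
        and frame: "\<And>x. 32 \<le> x \<or> x \<in> {0, 5, 12, 14, 15} \<Longrightarrow>
          x \<notin> {?r, ?r + 1, ?r + 2, ?r + 3, 31 + 2 * l} \<Longrightarrow> W' x = W x"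
        by blast
      have "sweep_inv (Suc p) W'"
      proof (rule step)
        show "partner k J p (W' (38 + 2 * n + 4 * p))"
          using partner W'(6) by (simp add: add_ac)
        show "W' x = W x" if "32 \<le> x \<or> x \<in> {0, 5, 12, 14, 15}" "x < 36 + 2 * n + 4 * p"
          "\<And>j. x \<noteq> 33 + 2 * j \<or> J < j" for x
          using that(1,2) that(3)[of "l - 1"] l1 l_bounds by (intro frame) auto
        have "nest k J (l - 1) ((\<lambda>j. W (33 + 2 * j))(l - 1 := p)) (Suc p)"
          using nest_open[OF nest 2(1,2)] False by simp
        then have "nest k J (l - 1) (\<lambda>j. W' (33 + 2 * j)) (Suc p)"
        proof (rule nest_cong)
          fix j assume j: "l - 1 \<le> j" "j \<le> J"
          show "W' (33 + 2 * j) = ((\<lambda>j. W (33 + 2 * j))(l - 1 := p)) j"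
          proof (cases "j = l - 1")
            case True
            then show ?thesis
              by (simp only: fun_upd_same l1(1) W'(8))
          next
            case False
            have "33 + 2 * j \<notin> {?r, ?r + 1, ?r + 2, ?r + 3, 31 + 2 * l}"
              using False j J_less assms l_bounds by auto
            then show ?thesis
              using frame[of "33 + 2 * j"] False by simp
          qed
        qed
        then show "\<exists>l. W' 3 = 32 + 2 * l \<and> nest k J l (\<lambda>j. W' (33 + 2 * j)) (Suc p)"
          using W'(2) l1(2) by auto
      qed (use W' in \<open>auto simp: add_ac\<close>)
      then show ?thesis
        using run by blast
    qed
  qed
qed

lemma sweep:
  "1 \<le> p \<Longrightarrow> p \<le> n \<Longrightarrow> sweep_inv p W \<Longrightarrow>
    \<exists>W'. reaches b spanner_program (23 * (n - p)) (21, W, R) (21, W', R) \<and> sweep_inv n W'"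
proof (induction "n - p" arbitrary: p W)
  case 0
  then have "p = n"
    by simp
  with 0 show ?case
    by (intro exI[of _ W]) (simp add: reaches_eq)
next
  case (Suc d)
  then have p: "p < n" "23 * (n - p) = 23 + 23 * (n - Suc p)" "d = n - Suc p"
    by auto
  obtain W1 where W1: "reaches b spanner_program 23 (21, W, R) (21, W1, R)" "sweep_inv (Suc p) W1"
    using sweep_step Suc.prems p(1) by blast
  obtain W2 where "reaches b spanner_program (23 * (n - Suc p)) (21, W1, R) (21, W2, R)" "sweep_inv n W2"
    using Suc.hyps(1)[OF p(3) _ _ W1(2)] p(1) by auto
  then show ?case
    unfolding p(2) using reaches_trans[OF W1(1)] by blast
qed

lemma sweep_output:
  assumes "sweep_inv n W" "length xs = n"
  shows "ram_output xs (W(0 := 2 * (n - 1), 1 := 40 + 2 * n)) (line_graph xs (spanner_pairs k J n))"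
proof -
  have out: "W (40 + 2 * n + 4 * i) = i" "W (41 + 2 * n + 4 * i) = Suc i"
      "partner k J (Suc i) (W (42 + 2 * n + 4 * i))" "W (43 + 2 * n + 4 * i) = Suc i"
    if "i < n - 1" for i
    using assms(1) that by (auto simp: sweep_inv_def)
  \<comment> \<open>Decodes edge number \<open>j\<close> of the output: path edges for even
    \<open>j\<close>, partner edges for odd \<open>j\<close>.\<close>
  define pair where "pair j = (W (40 + 2 * n + 2 * j), W (40 + 2 * n + 2 * j + 1))" for j
  have even_pair: "pair (2 * i) = (i, Suc i)" if "i < n - 1" for i
    using out[OF that] by (simp add: pair_def add_ac)
  have odd_pair: "pair (2 * i + 1) = (W (42 + 2 * n + 4 * i), Suc i)" if "i < n - 1" for i
    using out[OF that] by (simp add: pair_def add_ac)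
  have pair_in: "pair j \<in> spanner_pairs k J n" if "j < 2 * (n - 1)" for j
  proof -
    obtain i where "j = 2 * i \<or> j = 2 * i + 1"
      by (metis oddE evenE)
    moreover have "i < n - 1"
      using calculation that by auto
    moreover have "(W (42 + 2 * n + 4 * i), Suc i) \<in> spanner_pairs k J n"
      using out(3)[OF \<open>i < n - 1\<close>] \<open>i < n - 1\<close>
      by (auto simp: partner_def spanner_pairs_def path_pairs_def split: if_splits)
    moreover have "(i, Suc i) \<in> spanner_pairs k J n"
      using \<open>i < n - 1\<close> by (auto simp: spanner_pairs_def path_pairs_def)
    ultimately show ?thesis
      using even_pair odd_pair by auto
  qed
  have in_pair: "\<exists>j<2 * (n - 1). pair j = (u, v)" if uv: "(u, v) \<in> spanner_pairs k J n" for u v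
  proof -
    consider "v = Suc u" "Suc u < n" | "(u, v) \<in> blocks k J 0" "u < v" "v < n"
      using uv by (auto simp: spanner_pairs_def path_pairs_def)
    then show ?thesis
    proof cases
      case 1
      then show ?thesis
        using even_pair[of u] by (intro exI[of _ "2 * u"]) auto
    next
      case 2
      then obtain i where i: "v = Suc i" "i < n - 1"
        by (cases v) auto
      then have "(W (42 + 2 * n + 4 * i), v) \<in> blocks k J 0"
        using out(3)[OF i(2)] 2 by (auto simp: partner_def split: if_splits)
      \<comment> \<open>\<open>partner\<close> promises some start of a block closing at
        \<open>v\<close>; uniqueness of ends makes it \<open>u\<close>.\<close>
      then have "W (42 + 2 * n + 4 * i) = u"
        using blocks_endpoint_unique[OF _ 2(1)] by auto
      then show ?thesis
        using odd_pair[OF i(2)] i by (intro exI[of _ "2 * i + 1"]) auto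
    qed
  qed
  have pair_bounds: "fst (pair j) < n \<and> snd (pair j) < n" if "j < 2 * (n - 1)" for j
    using pair_in[OF that] by (cases "pair j") (auto simp: spanner_pairs_def path_pairs_def)
  have "line_graph xs (spanner_pairs k J n) = {{xs ! fst (pair j), xs ! snd (pair j)} | j. j < 2 * (n - 1)}"
  proof (intro equalityI subsetI)
    fix e assume "e \<in> line_graph xs (spanner_pairs k J n)"
    then obtain u v where "(u, v) \<in> spanner_pairs k J n" "e = {xs ! u, xs ! v}"
      by (auto simp: line_graph_def)
    then show "e \<in> {{xs ! fst (pair j), xs ! snd (pair j)} | j. j < 2 * (n - 1)}"
      using in_pair[of u v] by force
  next
    fix e assume "e \<in> {{xs ! fst (pair j), xs ! snd (pair j)} | j. j < 2 * (n - 1)}"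
    then show "e \<in> line_graph xs (spanner_pairs k J n)"
      using pair_in line_graphI[of _ _ "spanner_pairs k J n" xs] by force
  qed
  then show ?thesis
    using pair_bounds assms(2) by (simp add: ram_output_def pair_def)
qed

lemma spanner_program_constructs:
  assumes "length xs = n"
  shows "ram_constructs b spanner_program (50 * n) xs k (line_graph xs (spanner_pairs k J n))"
proof -
  obtain W R where input: "ram_input xs k = (0, W, R)" "W 0 = n" "W 1 = k"
    using assms by (simp add: ram_input_def)
  let ?W = "W(5 := 1, 3 := 32, 6 := 1, 12 := 2, 32 := 1)"
  have run0: "reaches b spanner_program 5 (0, W, R) (5, ?W, R)"
    using b k by (intro initialize) auto
  have "size_inv 0 ?W"
    using input by (simp add: size_inv_def)
  then obtain W1 where run1: "reaches b spanner_program (6 * J) (5, ?W, R) (5, W1, R)" and "size_inv J W1"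
    using size_loop[of 0] by auto
  then obtain W2 where run2: "reaches b spanner_program 11 (5, W1, R) (21, W2, R)" and "sweep_inv 1 W2"
    using sweep_start by blast
  then obtain W3 where run3: "reaches b spanner_program (23 * (n - 1)) (21, W2, R) (21, W3, R)"
    and inv: "sweep_inv n W3"
    using sweep[of 1] k by auto
  let ?W4 = "W3(0 := 2 * (n - 1), 1 := 40 + 2 * n)"
  have run4: "reaches b spanner_program 5 (21, W3, R) (50, ?W4, R)"
    using inv b k by (intro sweep_exit) (auto simp: sweep_inv_def)
  note run = reaches_trans[OF reaches_trans[OF reaches_trans[OF reaches_trans[OF run0 run1] run2] run3] run4]
  \<comment> \<open>The sum is \<open>21 + 6 * J + 23 * (n - 1)\<close>, below \<open>29 * n\<close>
    by \<open>J \<le> n\<close>.\<close>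
  have "reaches b spanner_program (50 * n) (0, W, R) (50, ?W4, R)"
    by (rule reaches_mono[OF run]) (use J_less k in simp)
  then have "ram_run b spanner_program (50 * n) (0, W, R) = Some (50, ?W4, R)"
    by (rule reaches_halted) (simp add: length_spanner_program)
  then show ?thesis
    unfolding ram_constructs_def input(1) using sweep_output[OF inv assms]
    by (auto simp: length_spanner_program)
qed

end

section \<open>Planarity, diameter and weight of the spanner\<close>

lemma spanner_pairs_ordered: "(u, v) \<in> spanner_pairs k J n \<Longrightarrow> u < v \<and> v < n"
  by (auto simp: spanner_pairs_def path_pairs_def)

text \<open>No position lies strictly between the ends of a path edge, so it crosses nothing; two
  different matching pairs are separated.\<close>

lemma spanner_pairs_noncrossing:
  assumes "(u, v) \<in> spanner_pairs k J n" "(u', v') \<in> spanner_pairs k J n"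
  shows "v \<le> u' \<or> v' \<le> u \<or> u \<le> u' \<and> v' \<le> v \<or> u' \<le> u \<and> v \<le> v'"
proof (cases "(u, v) \<in> path_pairs n \<or> (u', v') \<in> path_pairs n")
  case True
  then show ?thesis
    using spanner_pairs_ordered[OF assms(1)] spanner_pairs_ordered[OF assms(2)]
    by (auto simp: path_pairs_def)
next
  case False
  then have "(u, v) \<in> blocks k J 0" "(u', v') \<in> blocks k J 0"
    using assms by (auto simp: spanner_pairs_def)
  then show ?thesis
    using blocks_separated[of "(u, v)" k J 0 "(u', v')"] by (auto simp: separated_def)
qed

lemma spanner_pairs_relpow:
  assumes "1 \<le> k" "n \<le> bsize k J" "u < v" "v < n"
  shows "\<exists>l\<le>4 * k * J. (u, v) \<in> spanner_pairs k J n ^^ l"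
proof -
  define F where "F = {(i, Suc i) | i. True} \<union> {e \<in> blocks k J 0. fst e < snd e}"
  have increasing: "x < y" if "(x, y) \<in> F" for x y
    using that by (auto simp: F_def)
  have "hops F (4 * k * J) u v"
    by (rule hops_within[where a = 0]) (use assms in \<open>auto simp: F_def\<close>)
  then obtain l where l: "l \<le> 4 * k * J" "(u, v) \<in> F ^^ l"
    by (auto simp: hops_def)
  have "(u, v) \<in> spanner_pairs k J n ^^ l"
    using l(2) assms(4)
  proof (induction l arbitrary: v)
    case (Suc l)
    then obtain w where w: "(u, w) \<in> F ^^ l" "(w, v) \<in> F"
      by auto
    then have "w < n"
      using increasing Suc.prems(2) by (meson order_less_trans)
    moreover have "(w, v) \<in> spanner_pairs k J n"
      using w(2) Suc.prems(2) by (auto simp: F_def spanner_pairs_def path_pairs_def)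
    ultimately show ?case
      using Suc.IH[OF w(1)] by auto
  qed simp
  then show ?thesis
    using l(1) by blast
qed

lemma spanner_pairs_weight:
  assumes "sorted_wrt (<) xs" "length xs = n" "1 \<le> n" "1 \<le> k"
  shows "(\<Sum>(u, v)\<in>spanner_pairs k J n. xs ! v - xs ! u) \<le> (real J + 1) * (xs ! (n - 1) - xs ! 0)"
proof -
  \<comment> \<open>Coordinates are continued as a constant beyond the last point. They stay
    monotone, so the untruncated block can be measured, and its extent is at most that of the point
    set.\<close>
  define x where "x i = xs ! min i (n - 1)" for i
  let ?w = "\<lambda>(u, v). x v - x u"
  have sorted_le: "xs ! i \<le> xs ! j" if "i \<le> j" "j < n" for i j
    using sorted_wrt_nth_less[OF assms(1), of i j] assms(2) that by (cases "i = j") auto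
  have mono: "mono x"
    unfolding x_def using assms(3) by (intro monoI sorted_le) auto
  have nonneg: "0 \<le> x v - x u" if "u \<le> v" for u v
    using monoD[OF mono that] by simp
  have "inj_on (\<lambda>i. (i, Suc i)) {..<n - 1}"
    by (auto simp: inj_on_def)
  moreover have path_image: "path_pairs n = (\<lambda>i. (i, Suc i)) ` {..<n - 1}"
    by (auto simp: path_pairs_def)
  ultimately have "sum ?w (path_pairs n) = (\<Sum>i<n - 1. x (Suc i) - x i)"
    by (simp add: sum.reindex)
  also have "\<dots> = x (n - 1) - x 0"
    by (rule sum_lessThan_telescope)
  finally have path: "sum ?w (path_pairs n) = x (n - 1) - x 0" .
  have "sum ?w {(u, v) \<in> blocks k J 0. u < v \<and> v < n} \<le> sum ?w (blocks k J 0)"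
    using nonneg blocks_bounds by (intro sum_mono2 finite_blocks) fastforce+
  also have "\<dots> \<le> real J * (x (0 + bsize k J - 1) - x 0)"
    by (rule sum_blocks_le[OF mono])
  also have "\<dots> \<le> real J * (x (n - 1) - x 0)"
    using assms(3) by (intro mult_left_mono diff_right_mono) (auto simp: x_def intro!: sorted_le)
  finally have blocks: "sum ?w {(u, v) \<in> blocks k J 0. u < v \<and> v < n} \<le> real J * (x (n - 1) - x 0)" .
  have fin: "finite (path_pairs n)" "finite {(u, v) \<in> blocks k J 0. u < v \<and> v < n}"
    using path_image finite_subset[OF _ finite_blocks] by (auto intro: finite_subset[OF _ finite_blocks])
  have "sum ?w (spanner_pairs k J n) \<le> sum ?w (path_pairs n) + sum ?w {(u, v) \<in> blocks k J 0. u < v \<and> v < n}"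
    unfolding spanner_pairs_def using fin sum.union_inter[OF fin, of ?w]
      sum_nonneg[of "path_pairs n \<inter> {(u, v) \<in> blocks k J 0. u < v \<and> v < n}" ?w] nonneg
    by fastforce
  also have "\<dots> \<le> (real J + 1) * (x (n - 1) - x 0)"
    using path blocks by (simp add: algebra_simps)
  finally have "sum ?w (spanner_pairs k J n) \<le> (real J + 1) * (xs ! (n - 1) - xs ! 0)"
    by (simp add: x_def)
  moreover have "sum ?w (spanner_pairs k J n) = (\<Sum>(u, v)\<in>spanner_pairs k J n. xs ! v - xs ! u)"
    using spanner_pairs_ordered by (intro sum.cong) (fastforce simp: x_def)+
  ultimately show ?thesis
    by simp
qed

lemma finite_spanner_pairs: "finite (spanner_pairs k J n)"
  by (rule finite_subset[of _ "{..<n} \<times> {..<n}"]) (use spanner_pairs_ordered in fastforce)+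

theorem theorem2p2:
  shows "\<exists>(C_diam :: real) (C_light :: real) (C_time :: nat) (w :: nat) (P :: ram_program).
    \<forall>(n :: nat) (k :: nat) (xs :: real list).
      2 \<le> n \<longrightarrow> length xs = n \<longrightarrow> sorted_wrt (<) xs \<longrightarrow> 2 \<le> k \<longrightarrow> k \<le> n \<longrightarrow>
      (\<exists>E. one_spanner (set xs) E \<and>
           max_degree (set xs) E \<le> 3 \<and>
           real (spanner_diameter (set xs) E) \<le> C_diam * (real k * log (real k) (real n)) \<and>
           lightness (set xs) E \<le> C_light * log (real k) (real n) \<and>
           planar_graph (set xs) E \<and>
           ram_constructs (n ^ w) P (C_time * n) xs k E)"
\<comment> \<open>The constants \<open>8\<close> and \<open>3\<close> come from the bounds
  \<open>4 * k * J\<close> and \<open>J + 1\<close>, by \<open>J \<le> 2 * log k n\<close> and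
  \<open>1 \<le> log k n\<close>. The exponent \<open>8\<close> gives
  \<open>n ^ 8 \<ge> 64 * (n * n) > n * n + 100 * n\<close> for \<open>n \<ge> 2\<close>.\<close>
proof (rule exI[of _ 8], rule exI[of _ 3], rule exI[of _ 50], rule exI[of _ 8],
    rule exI[of _ spanner_program], intro allI impI)
  fix n k :: nat and xs :: "real list"
  assume n: "2 \<le> n" and len: "length xs = n" and sorted: "sorted_wrt (<) xs" and k: "2 \<le> k" "k \<le> n"
  define J where "J = (LEAST j. n \<le> bsize k j)"
  have "n \<le> bsize k n"
    using less_bsize[of k n] k by simp
  then have J: "n \<le> bsize k J"
    unfolding J_def by (rule LeastI)
  have J_least: "bsize k j < n" if "j < J" for j
    using not_less_Least[of j "\<lambda>j. n \<le> bsize k j"] that by (simp add: J_def)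
  have "64 * (n * n) \<le> n ^ 8"
  proof -
    have "2 ^ 6 * n ^ 2 \<le> n ^ 6 * n ^ 2"
      using n by (intro mult_le_mono1 power_mono) auto
    also have "n ^ 6 * n ^ 2 = n ^ 8"
      by (simp flip: power_add)
    finally show ?thesis
      by (simp add: power2_eq_square)
  qed
  moreover have "2 * n \<le> n * n"
    using n by (rule mult_le_mono1)
  ultimately have b: "n * n + 100 * n < n ^ 8"
    using n by linarith
  interpret spanner_run n k J "n ^ 8"
    by unfold_locales (use k J J_least b in auto)
  let ?F = "spanner_pairs k J n" and ?L = "log (real k) (real n)"
  let ?E = "line_graph xs ?F"
  have ordered: "u < v \<and> v < length xs" if "(u, v) \<in> ?F" for u v
    using spanner_pairs_ordered[OF that] len by simp
  have log_ge_1: "1 \<le> ?L"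
    using k by (simp add: le_log_iff)
  \<comment> \<open>Level \<open>J - 1\<close> has at least \<open>k ^ (J - 1)\<close> but fewer
    than \<open>n\<close> positions, and the remaining level is absorbed by
    \<open>1 \<le> log k n\<close>.\<close>
  have J_log: "real J \<le> 2 * ?L"
  proof -
    obtain J' where J': "J = Suc J'"
      using J_pos by (cases J) auto
    have "k ^ J' \<le> n"
      using power_le_bsize[of k J'] J_least[of J'] J' by simp
    then have "real k ^ J' \<le> real n"
      by (metis of_nat_le_iff of_nat_power)
    then have "real J' \<le> ?L"
      using k by (simp add: le_log_iff powr_realpow)
    then show ?thesis
      using J' log_ge_1 by simp
  qed
  have paths: "\<exists>l\<le>4 * k * J. (u, v) \<in> ?F ^^ l" if "u < v" "v < length xs" for u v
    using spanner_pairs_relpow[of k n J] that J k len by simp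
  show "\<exists>E. one_spanner (set xs) E \<and> max_degree (set xs) E \<le> 3 \<and>
      real (spanner_diameter (set xs) E) \<le> 8 * (real k * ?L) \<and>
      lightness (set xs) E \<le> 3 * ?L \<and> planar_graph (set xs) E \<and>
      ram_constructs (n ^ 8) spanner_program (50 * n) xs k E"
  proof (intro exI[of _ ?E] conjI)
    show "one_spanner (set xs) ?E"
      by (rule one_spanner_line_graph(1)[OF sorted ordered paths])
    show "max_degree (set xs) ?E \<le> 3"
    proof (rule max_degree_line_graph[OF sorted ordered])
      show "?F = path_pairs (length xs) \<union> {(u, v) \<in> blocks k J 0. u < v \<and> v < n}"
        by (simp add: spanner_pairs_def len)
      show "xs \<noteq> []"
        using n len by auto
      show "u = u' \<and> v = v'"
        if "(u, v) \<in> {(u, v) \<in> blocks k J 0. u < v \<and> v < n}"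
          "(u', v') \<in> {(u, v) \<in> blocks k J 0. u < v \<and> v < n}" "{u, v} \<inter> {u', v'} \<noteq> {}" for u v u' v'
        by (rule blocks_endpoint_unique[OF _ _ that(3)]) (use that(1,2) in auto)
    qed
    have "spanner_diameter (set xs) ?E \<le> 4 * k * J"
      by (rule one_spanner_line_graph(2)[OF sorted ordered paths])
    then have "real (spanner_diameter (set xs) ?E) \<le> 4 * real k * real J"
      by (metis of_nat_le_iff of_nat_mult of_nat_numeral)
    also have "\<dots> \<le> 4 * real k * (2 * ?L)"
      using J_log by (intro mult_left_mono) auto
    finally show "real (spanner_diameter (set xs) ?E) \<le> 8 * (real k * ?L)"
      by simp
    show "planar_graph (set xs) ?E"
      by (rule planar_line_graph[OF sorted ordered spanner_pairs_noncrossing])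
    show "ram_constructs (n ^ 8) spanner_program (50 * n) xs k ?E"
      by (rule spanner_program_constructs[OF len])
    let ?D = "xs ! (n - 1) - xs ! 0"
    have D: "0 < ?D"
      using sorted_wrt_nth_less[OF sorted, of 0 "n - 1"] len n by simp
    have "graph_weight ?E \<le> (\<Sum>(u, v)\<in>?F. xs ! v - xs ! u)"
      by (rule graph_weight_line_graph_le[OF sorted ordered finite_spanner_pairs])
    also have "\<dots> \<le> (real J + 1) * ?D"
      by (rule spanner_pairs_weight[OF sorted len]) (use n k in auto)
    finally have "graph_weight ?E \<le> (real J + 1) * ?D" .
    moreover have "xs \<noteq> []"
      using n len by auto
    then have mst: "?D \<le> mst_weight (set xs)"
      using mst_weight_ge[OF sorted] len by blast
    ultimately have "graph_weight ?E \<le> (real J + 1) * mst_weight (set xs)"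
      by (meson mult_left_mono order_trans of_nat_0_le_iff add_nonneg_nonneg zero_le_one)
    then have "lightness (set xs) ?E \<le> real J + 1"
      unfolding lightness_def using D mst by (simp add: pos_divide_le_eq)
    then show "lightness (set xs) ?E \<le> 3 * ?L"
      using J_log log_ge_1 by simp
  qed
qed

end
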